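(* The taut string energy constant $\mathcal{C}$ (defined in the context) satisfies $$\mathcal{C}\le\frac{\pi}{2}.$$
   Context: $W=(W(t))_{0\le t\le 1}$ is a standard one-dimensional Wiener process with $W(0)=0$. $\|h\|_1:=\sup_{0\le t\le 1}|h(t)|$; $AC[0,1]$ is the set of absolutely continuous real functions on $[0,1]$, and $|h|_1:=\left(\int_0^1 h'(t)^2\,dt\right)^{1/2}$ (possibly $+\infty$). For $\varepsilon>0$, $$I_W(1,\varepsilon):=\inf\{|h|_1:\ h\in AC[0,1],\ \|h-W\|_1\le\varepsilon,\ h(0)=0\}.$$ The constant $\mathcal{C}\in[0,\infty)$ is the (unique) deterministic number such that, for every $q>0$, $\mathbb{E}\left|\varepsilon I_W(1,\varepsilon)-\mathcal{C}\right|^q\to 0$ as $\varepsilon\to 0$; the existence of such a constant is another theorem of the paper. *)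

theory Defs
  imports "HOL-Probability.Probability"
begin

text \<open>The process is indexed by all reals, but only its restriction to \<open>[0, 1]\<close> is constrained
  and used. The starting point and the continuity of the paths are required almost surely.\<close>

definition wiener_process :: "'a measure \<Rightarrow> (real \<Rightarrow> 'a \<Rightarrow> real) \<Rightarrow> bool" where
  "wiener_process M W \<longleftrightarrow>
     prob_space M \<and>
     (\<forall>t\<in>{0..1}. W t \<in> borel_measurable M) \<and>
     (AE \<omega> in M. W 0 \<omega> = 0) \<and>
     (AE \<omega> in M. continuous_on {0..1} (\<lambda>t. W t \<omega>)) \<and>
     (\<forall>s t. 0 \<le> s \<and> s < t \<and> t \<le> 1 \<longrightarrow>
        distributed M lborel (\<lambda>\<omega>. W t \<omega> - W s \<omega>) (normal_density 0 (sqrt (t - s)))) \<and>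
     (\<forall>(n::nat) (t::nat \<Rightarrow> real).
        0 \<le> t 0 \<and> (\<forall>i<n. t i < t (Suc i)) \<and> t n \<le> 1 \<longrightarrow>
        prob_space.indep_vars M (\<lambda>_. borel) (\<lambda>i \<omega>. W (t (Suc i)) \<omega> - W (t i) \<omega>) {..<n})"

definition absolutely_continuous_on :: "real set \<Rightarrow> (real \<Rightarrow> real) \<Rightarrow> bool" where
  "absolutely_continuous_on S f \<longleftrightarrow>
     (\<forall>\<epsilon>>0. \<exists>\<delta>>0. \<forall>(n::nat) (a::nat \<Rightarrow> real) (b::nat \<Rightarrow> real).
        (\<forall>i<n. a i \<le> b i \<and> {a i..b i} \<subseteq> S) \<and>
        disjoint_family_on (\<lambda>i. {a i<..<b i}) {..<n} \<and>
        (\<Sum>i<n. b i - a i) < \<delta> \<longrightarrow>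
        (\<Sum>i<n. \<bar>f (b i) - f (a i)\<bar>) < \<epsilon>)"

text \<open>The norm \<open>|h|\<^sub>1\<close>. For absolutely continuous \<open>h\<close> the derivative exists almost everywhere
  on \<open>[0, 1]\<close>, so the arbitrary value of \<^const>\<open>deriv\<close> at other points is irrelevant.\<close>

definition energy_norm :: "(real \<Rightarrow> real) \<Rightarrow> ennreal" where
  "energy_norm h =
     (let E = (\<integral>\<^sup>+t\<in>{0..1}. ennreal ((deriv h t)\<^sup>2) \<partial>lborel)
      in if E = \<infinity> then \<infinity> else ennreal (sqrt (enn2real E)))"

text \<open>\<open>I\<^sub>w(1, \<epsilon>)\<close> for a fixed path \<open>w\<close>. The uniform distance is taken in \<^typ>\<open>ennreal\<close>, where it
  is meaningful for unbounded functions as well.\<close>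

definition taut_string_energy :: "(real \<Rightarrow> real) \<Rightarrow> real \<Rightarrow> ennreal" where
  "taut_string_energy w \<epsilon> =
     (INF h\<in>{h. absolutely_continuous_on {0..1} h \<and>
                (SUP t\<in>{0..1}. ennreal \<bar>h t - w t\<bar>) \<le> ennreal \<epsilon> \<and> h 0 = 0}.
        energy_norm h)"

text \<open>\<open>|\<epsilon> I - C|^q\<close> for an extended value \<open>I\<close>.\<close>

definition scaled_deviation :: "real \<Rightarrow> real \<Rightarrow> real \<Rightarrow> ennreal \<Rightarrow> ennreal" where
  "scaled_deviation C q \<epsilon> I =
     (if I = \<infinity> then \<infinity> else ennreal (\<bar>\<epsilon> * enn2real I - C\<bar> powr q))"

text \<open>The expectation is a nonnegative integral with values in \<open>[0, \<infinity>]\<close>, so a moment which is not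
  finite is not replaced by \<open>0\<close>, as the Bochner integral would do.\<close>

definition is_taut_string_constant :: "'a measure \<Rightarrow> (real \<Rightarrow> 'a \<Rightarrow> real) \<Rightarrow> real \<Rightarrow> bool" where
  "is_taut_string_constant M W C \<longleftrightarrow>
     0 \<le> C \<and>
     (\<forall>q>0. ((\<lambda>\<epsilon>. \<integral>\<^sup>+\<omega>. scaled_deviation C q \<epsilon> (taut_string_energy (\<lambda>t. W t \<omega>) \<epsilon>) \<partial>M)
              \<longlongrightarrow> 0) (at_right 0))"

end

theory Submission
  imports Defs
begin

text \<open>
An explicit pursuit strategy proves the bound. Let \<open>h\<close> follow the path by the rule
\<open>h' = b (h - W)\<close> with \<open>b x = - \<alpha> tan (\<alpha> x)\<close>. The difference \<open>X = h - W\<close> is then the diffusion with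
drift \<open>b\<close>, which is repelled by \<open>\<plusminus> pi / (2 \<alpha>)\<close>. For the potential \<open>V x = - 2 ln (cos (\<alpha> x))\<close> one has
\<open>V' = - 2 b\<close> and \<open>V'' = 2 (\<alpha>\<^sup>2 + b\<^sup>2)\<close>, hence \<open>V' b + V'' / 2 + b\<^sup>2 = \<alpha>\<^sup>2\<close>: the sum of \<open>V (X t)\<close> and of
the energy spent up to time \<open>t\<close> grows on average at the rate \<open>\<alpha>\<^sup>2\<close>. Since \<open>V \<ge> 0\<close>, the expected
energy on \<open>[0, 1]\<close> is at most \<open>\<alpha>\<^sup>2\<close>, and \<open>h\<close> stays \<open>\<epsilon>\<close>-close to \<open>W\<close> whenever
\<open>\<alpha> > pi / (2 \<epsilon>)\<close>. As \<open>\<epsilon> \<alpha>\<close> may be taken arbitrarily close to \<open>pi / 2\<close>, the constant follows.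

The proof works in discrete time: \<open>\<alpha>\<close> and \<open>\<epsilon>\<close> are kept fixed while the strategy is
discretised with step \<open>1 / m\<close> and \<open>m\<close> tends to infinity. The discrete version of \<open>X\<close> is a walk driven
by the independent Gaussian increments of \<open>W\<close>, frozen as soon as it leaves \<open>[- a, a]\<close> for some
\<open>a < pi / (2 \<alpha>)\<close>. On that interval \<open>V\<close> is smooth, and Taylor expansion replaces Ito's formula
(\<open>potential_step\<close>, \<open>walk_expected_cost\<close>). If \<open>a\<close> is chosen such that \<open>V a = \<rho>\<close>, one application of
Markov's inequality to the sum of potential and cost bounds the probability that the walk leaves
\<open>[- a, a]\<close> or spends more than \<open>\<rho>\<close>. Between grid points only the modulus of continuity of the path
matters; for large \<open>m\<close> it is small with probability close to one
(\<open>small_oscillation_events\<close>).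

The outcome is \<open>taut_string_energy_small_with_positive_probability\<close>: for \<open>pi / 2 < \<theta> < r\<close> the scaled
energy is at most \<open>r\<close> with a probability bounded below independently of \<open>\<epsilon>\<close>. This excludes
convergence in mean to any \<open>C > r\<close>. Only upper bounds for the energy on measurable events enter, so
the measurability of the energy itself is never at issue.
\<close>

section \<open>The potential and the pursuit drift\<close>

text \<open>Clamping \<open>\<bar>x\<bar>\<close> at \<open>a\<close> keeps the argument of the logarithm positive and makes the
potential bounded, so that a large Gaussian step does no harm.\<close>

definition potential :: "real \<Rightarrow> real \<Rightarrow> real \<Rightarrow> real" where
  "potential \<alpha> a x = - 2 * ln (cos (\<alpha> * min \<bar>x\<bar> a))"

definition drift :: "real \<Rightarrow> real \<Rightarrow> real" where
  "drift \<alpha> x = - \<alpha> * tan (\<alpha> * x)"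

lemma abs_mult_less_half_pi:
  assumes "\<alpha> > 0" "\<alpha> * a < pi / 2" "\<bar>x\<bar> \<le> a"
  shows "\<bar>\<alpha> * x\<bar> < pi / 2"
proof -
  have "\<alpha> * \<bar>x\<bar> \<le> \<alpha> * a" using assms by (intro mult_left_mono) auto
  then have "\<alpha> * \<bar>x\<bar> < pi / 2" using assms by linarith
  then show ?thesis using assms by (simp add: abs_mult)
qed

lemma cos_pos_below:
  assumes "\<alpha> > 0" "\<alpha> * a < pi / 2" "\<bar>x\<bar> \<le> a"
  shows "cos (\<alpha> * x) > 0"
  using abs_mult_less_half_pi[OF assms] by (intro cos_gt_zero_pi) auto

lemma abs_tan_le:
  assumes "\<alpha> > 0" "\<alpha> * a < pi / 2" "\<bar>x\<bar> \<le> a"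
  shows "\<bar>tan (\<alpha> * x)\<bar> \<le> tan (\<alpha> * a)"
proof -
  have b: "\<bar>\<alpha> * x\<bar> < pi / 2" by (rule abs_mult_less_half_pi[OF assms])
  have le: "\<bar>\<alpha> * x\<bar> \<le> \<alpha> * a" using assms by (simp add: abs_mult)
  have "\<bar>tan (\<alpha> * x)\<bar> = tan \<bar>\<alpha> * x\<bar>"
    using b tan_pos_pi2_le[of "\<bar>\<alpha> * x\<bar>"] by (cases "\<alpha> * x \<ge> 0") (auto simp: abs_if)
  also have "\<dots> \<le> tan (\<alpha> * a)"
    using b le assms by (intro tan_mono_le) auto
  finally show ?thesis .
qed

lemma potential_inside:
  assumes "\<alpha> > 0" "\<bar>x\<bar> \<le> a"
  shows "potential \<alpha> a x = - 2 * ln (cos (\<alpha> * x))"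
proof -
  have "cos (\<alpha> * \<bar>x\<bar>) = cos (\<alpha> * x)" by (cases "x \<ge> 0") auto
  then show ?thesis using assms by (simp add: potential_def min_def)
qed

lemma potential_outside: "\<bar>x\<bar> > a \<Longrightarrow> potential \<alpha> a x = - 2 * ln (cos (\<alpha> * a))"
  by (simp add: potential_def)

lemma potential_mono:
  assumes "\<alpha> > 0" "0 \<le> a" "a \<le> c" "\<alpha> * c < pi / 2"
  shows "potential \<alpha> a x \<le> potential \<alpha> c x"
proof -
  have "\<alpha> * min \<bar>x\<bar> c \<le> \<alpha> * c" using assms by (intro mult_left_mono) auto
  then have r: "\<alpha> * min \<bar>x\<bar> c < pi/2" using assms by linarith
  have "cos (\<alpha> * min \<bar>x\<bar> c) \<le> cos (\<alpha> * min \<bar>x\<bar> a)"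
  proof (rule cos_monotone_0_pi_le)
    show "\<alpha> * min \<bar>x\<bar> c \<le> pi" using r pi_gt_zero by linarith
  qed (use assms in \<open>auto intro!: mult_left_mono\<close>)
  moreover have "cos (\<alpha> * min \<bar>x\<bar> c) > 0"
  proof (rule cos_gt_zero_pi)
    have "0 \<le> \<alpha> * min \<bar>x\<bar> c" using assms by auto
    then show "- (pi/2) < \<alpha> * min \<bar>x\<bar> c" using pi_gt_zero by linarith
  qed (rule r)
  ultimately show ?thesis unfolding potential_def by (simp add: ln_mono)
qed

lemma potential_nonneg:
  assumes "\<alpha> > 0" "0 \<le> a" "\<alpha> * a < pi / 2"
  shows "potential \<alpha> a x \<ge> 0"
  using potential_mono[of \<alpha> 0 a x] assms by (simp add: potential_def)

text \<open>A second order expansion that holds for every increment \<open>d\<close>, with \<open>V'\<close> and \<open>V''\<close> written in terms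
of the drift. For small \<open>d\<close> the point \<open>x + d\<close> stays in a slightly larger interval \<open>[- c, c]\<close>, where
the unclamped potential is smooth and dominates the clamped one. For large \<open>d\<close> the clamped
potential is bounded, and the cubic term absorbs it.\<close>

lemma potential_taylor:
  assumes "\<alpha> > 0" "0 < a" "\<alpha> * a < pi / 2"
  obtains K where "K \<ge> 0"
    "\<And>x d. \<bar>x\<bar> \<le> a \<Longrightarrow> potential \<alpha> a (x + d) \<le>
       potential \<alpha> a x - 2 * drift \<alpha> x * d + (\<alpha>\<^sup>2 + (drift \<alpha> x)\<^sup>2) * d\<^sup>2 + K * \<bar>d\<bar> ^ 3"
proof -
  \<comment> \<open>The midpoint between \<open>a\<close> and the pole of the potential.\<close>
  define c where "c = (a + pi / (2 * \<alpha>)) / 2"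
  have "a < pi / (2 * \<alpha>)" using assms by (simp add: field_simps)
  then have ac: "a < c" by (simp add: c_def)
  have "c < pi / (2 * \<alpha>)" using \<open>a < pi / (2 * \<alpha>)\<close> by (simp add: c_def)
  then have c: "\<alpha> * c < pi / 2" using assms by (simp add: field_simps)
  define r T L where "r = c - a" and "T = tan (\<alpha> * c)" and "L = - 2 * ln (cos (\<alpha> * a))"
  have r: "r > 0" using ac by (simp add: r_def)
  have T: "T \<ge> 0" using c assms ac unfolding T_def by (intro less_imp_le tan_gt_zero mult_pos_pos) auto
  have L: "L \<ge> 0" using potential_nonneg[of \<alpha> a "a + 1"] potential_outside[of a "a+1" \<alpha>] assms
    by (simp add: L_def)
  have tb: "\<bar>tan (\<alpha> * x)\<bar> \<le> T" if "\<bar>x\<bar> \<le> c" for x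
    unfolding T_def using abs_tan_le[OF \<open>\<alpha> > 0\<close> c that] .
  define K1 where "K1 = 4 * \<alpha> ^ 3 * T * (1 + T\<^sup>2) / 6"
  define K2 where "K2 = L / r ^ 3 + 2 * \<alpha> * T / r\<^sup>2"
  have K1: "K1 \<ge> 0" using T assms by (simp add: K1_def)
  have K2: "K2 \<ge> 0" using T L r assms by (simp add: K2_def)
  show thesis
  proof (rule that[of "K1 + K2"])
    show "K1 + K2 \<ge> 0" using K1 K2 by simp
    fix x d :: real
    assume x: "\<bar>x\<bar> \<le> a"
    have p0: "potential \<alpha> a x \<ge> 0" using potential_nonneg assms by simp
    let ?R = "potential \<alpha> a x - 2 * drift \<alpha> x * d + (\<alpha>\<^sup>2 + (drift \<alpha> x)\<^sup>2) * d\<^sup>2"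
    show "potential \<alpha> a (x + d) \<le> ?R + (K1 + K2) * \<bar>d\<bar> ^ 3"
    proof (cases "\<bar>d\<bar> < r")
      case True
      have xd: "\<bar>x + d\<bar> \<le> c" using x True by (simp add: r_def)
      have xc: "\<bar>x\<bar> \<le> c" using x ac by simp
      \<comment> \<open>The unclamped potential followed by its first three derivatives.\<close>
      define G where "G = (\<lambda>(m::nat) t. if m = 0 then - 2 * ln (cos (\<alpha> * t))
         else if m = 1 then 2 * \<alpha> * tan (\<alpha> * t)
         else if m = 2 then 2 * \<alpha>\<^sup>2 * (1 + (tan (\<alpha> * t))\<^sup>2)
         else 4 * \<alpha> ^ 3 * tan (\<alpha> * t) * (1 + (tan (\<alpha> * t))\<^sup>2))"
      have der: "DERIV (G m) t :> G (Suc m) t" if "m < 3" "- c \<le> t" "t \<le> c" for m t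
      proof -
        have cp: "cos (\<alpha> * t) > 0" by (rule cos_pos_below[OF \<open>\<alpha> > 0\<close> c]) (use that in auto)
        have tt: "inverse ((cos (\<alpha> * t))\<^sup>2) = 1 + (tan (\<alpha> * t))\<^sup>2"
          using tan_sec[of "\<alpha> * t"] cp by (simp add: power_inverse)
        consider "m = 0" | "m = 1" | "m = 2" using \<open>m < 3\<close> by linarith
        then show ?thesis
        proof cases
          case 1
          then show ?thesis unfolding G_def using cp
            by (auto intro!: derivative_eq_intros simp: tan_def divide_simps)
        next
          case 2
          have "((\<lambda>t. 2 * \<alpha> * tan (\<alpha> * t)) has_real_derivative
              2 * \<alpha> * (inverse ((cos (\<alpha> * t))\<^sup>2) * \<alpha>)) (at t)"
            using cp by (auto intro!: derivative_eq_intros)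
          then show ?thesis using 2 unfolding tt G_def by (simp add: power2_eq_square mult_ac)
        next
          case 3
          have "((\<lambda>t. 2 * \<alpha>\<^sup>2 * (1 + (tan (\<alpha> * t))\<^sup>2)) has_real_derivative
              2 * \<alpha>\<^sup>2 * (2 * tan (\<alpha> * t) * (inverse ((cos (\<alpha> * t))\<^sup>2) * \<alpha>))) (at t)"
            using cp by (auto intro!: derivative_eq_intros)
          also have "2 * \<alpha>\<^sup>2 * (2 * tan (\<alpha> * t) * (inverse ((cos (\<alpha> * t))\<^sup>2) * \<alpha>))
              = 4 * \<alpha> ^ 3 * tan (\<alpha> * t) * (1 + (tan (\<alpha> * t))\<^sup>2)"
            unfolding tt by (simp add: power2_eq_square power3_eq_cube)
          finally show ?thesis using 3 by (simp add: G_def)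
        qed
      qed
      have "potential \<alpha> c (x + d) \<le> ?R + K1 * \<bar>d\<bar> ^ 3"
      proof (cases "d = 0")
        case True
        then show ?thesis
          using potential_inside[OF \<open>\<alpha> > 0\<close> x] potential_inside[OF \<open>\<alpha> > 0\<close> xc] by simp
      next
        case False
        have "\<exists>t. (if x + d < x then x + d < t \<and> t < x else x < t \<and> t < x + d) \<and>
           G 0 (x + d) = (\<Sum>m<3. G m x / fact m * (x + d - x) ^ m) + G 3 t / fact 3 * (x + d - x) ^ 3"
          by (rule Taylor[of 3 G "G 0" "- c" c x "x + d"]) (use der xc xd False in auto)
        then obtain t where t: "if x + d < x then x + d < t \<and> t < x else x < t \<and> t < x + d"
          and eq: "G 0 (x + d) = (\<Sum>m<3. G m x / fact m * (x + d - x) ^ m) + G 3 t / fact 3 * (x + d - x) ^ 3"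
          by blast
        have "\<bar>t\<bar> \<le> c" using t xc xd by (auto split: if_splits)
        then have tt: "\<bar>tan (\<alpha> * t)\<bar> \<le> T" by (rule tb)
        have "G 3 t / fact 3 * d ^ 3 \<le> \<bar>G 3 t / fact 3 * d ^ 3\<bar>" by (rule abs_ge_self)
        also have "\<dots> = (4 * \<alpha> ^ 3 * \<bar>tan (\<alpha> * t)\<bar> * (1 + \<bar>tan (\<alpha> * t)\<bar>\<^sup>2) / 6) * \<bar>d\<bar> ^ 3"
          using assms by (simp add: G_def abs_mult fact_numeral power_abs)
        also have "\<dots> \<le> K1 * \<bar>d\<bar> ^ 3"
          unfolding K1_def using assms tt T
          by (intro mult_right_mono divide_right_mono mult_mono add_mono power_mono) auto
        finally have rem: "G 3 t / fact 3 * d ^ 3 \<le> K1 * \<bar>d\<bar> ^ 3" .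
        have "(\<Sum>m<3. G m x / fact m * (x + d - x) ^ m) = ?R"
          using potential_inside[OF \<open>\<alpha> > 0\<close> x]
          by (simp add: G_def eval_nat_numeral drift_def algebra_simps)
        then show ?thesis using eq rem potential_inside[OF \<open>\<alpha> > 0\<close> xd] by (simp add: G_def)
      qed
      moreover have "K1 * \<bar>d\<bar> ^ 3 \<le> (K1 + K2) * \<bar>d\<bar> ^ 3" using K2 by (intro mult_right_mono) auto
      moreover have "potential \<alpha> a (x + d) \<le> potential \<alpha> c (x + d)"
        by (rule potential_mono) (use assms ac c in auto)
      ultimately show ?thesis by linarith
    next
      case False
      then have d: "\<bar>d\<bar> \<ge> r" by simp
      have "potential \<alpha> a (x + d) \<le> L"
      proof -
        have "\<alpha> * min \<bar>x + d\<bar> a \<le> \<alpha> * a" using assms by (intro mult_left_mono) auto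
        moreover have "\<alpha> * a \<le> pi" using assms pi_gt_zero by linarith
        ultimately have "cos (\<alpha> * a) \<le> cos (\<alpha> * min \<bar>x + d\<bar> a)"
          using assms by (intro cos_monotone_0_pi_le) auto
        moreover have "cos (\<alpha> * a) > 0" by (rule cos_pos_below[OF assms(1,3)]) (use assms in auto)
        ultimately show ?thesis by (simp add: potential_def L_def ln_mono)
      qed
      also have "L \<le> L / r ^ 3 * \<bar>d\<bar> ^ 3"
      proof -
        have "r ^ 3 \<le> \<bar>d\<bar> ^ 3" using d r by (intro power_mono) auto
        then have "L * r ^ 3 \<le> L * \<bar>d\<bar> ^ 3" using L by (intro mult_left_mono)
        then show ?thesis using r by (simp add: field_simps)
      qed
      finally have 1: "potential \<alpha> a (x + d) \<le> L / r ^ 3 * \<bar>d\<bar> ^ 3" .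
      have "2 * drift \<alpha> x * d \<le> \<bar>2 * drift \<alpha> x * d\<bar>" by simp
      also have "\<dots> = 2 * \<alpha> * \<bar>tan (\<alpha> * x)\<bar> * \<bar>d\<bar>" using assms by (simp add: drift_def abs_mult)
      also have "\<dots> \<le> 2 * \<alpha> * T * \<bar>d\<bar>"
        using tb[of x] x ac assms by (intro mult_right_mono mult_left_mono) auto
      also have "\<dots> \<le> 2 * \<alpha> * T / r\<^sup>2 * \<bar>d\<bar> ^ 3"
      proof -
        have "r\<^sup>2 \<le> \<bar>d\<bar>\<^sup>2" using d r by (intro power_mono) auto
        then have "(2 * \<alpha> * T * \<bar>d\<bar>) * r\<^sup>2 \<le> (2 * \<alpha> * T * \<bar>d\<bar>) * \<bar>d\<bar>\<^sup>2"
          using T assms by (intro mult_left_mono) auto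
        then show ?thesis using r by (simp add: field_simps power2_eq_square power3_eq_cube)
      qed
      finally have 2: "2 * drift \<alpha> x * d \<le> 2 * \<alpha> * T / r\<^sup>2 * \<bar>d\<bar> ^ 3" .
      have "(K1 + K2) * \<bar>d\<bar> ^ 3 = K1 * \<bar>d\<bar> ^ 3 + L / r ^ 3 * \<bar>d\<bar> ^ 3 + 2 * \<alpha> * T / r\<^sup>2 * \<bar>d\<bar> ^ 3"
        by (simp add: K2_def algebra_simps)
      moreover have "K1 * \<bar>d\<bar> ^ 3 \<ge> 0" using K1 by simp
      moreover have "(\<alpha>\<^sup>2 + (drift \<alpha> x)\<^sup>2) * d\<^sup>2 \<ge> 0" by simp
      ultimately show ?thesis using 1 2 p0 by linarith
    qed
  qed
qed
section \<open>The mean change of the potential in one step\<close>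

abbreviation gaussian :: "real \<Rightarrow> real measure" where
  "gaussian \<sigma> \<equiv> density lborel (\<lambda>y. ennreal (normal_density 0 \<sigma> y))"

lemma borel_measurable_potential [measurable]: "potential \<alpha> a \<in> borel_measurable borel"
  unfolding potential_def[abs_def] by measurable

lemma borel_measurable_drift [measurable]: "drift \<alpha> \<in> borel_measurable borel"
  unfolding drift_def[abs_def] tan_def by measurable

lemma gaussian_cubic_integral:
  assumes \<sigma>: "0 < \<sigma>" and nonneg: "\<And>y. 0 \<le> A + B * y + C * y\<^sup>2 + D * \<bar>y\<bar> ^ 3"
  shows "(\<integral>\<^sup>+y. ennreal (A + B * y + C * y\<^sup>2 + D * \<bar>y\<bar> ^ 3) \<partial>gaussian \<sigma>)
    = ennreal (A + C * \<sigma>\<^sup>2 + D * (2 * \<sigma> ^ 3 * sqrt (2 / pi)))"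
proof -
  let ?n = "normal_density 0 \<sigma>"
  have "has_bochner_integral lborel
      (\<lambda>y. ?n y * (y - 0) ^ (2 * 0) * A + ?n y * (y - 0) ^ (2 * 0 + 1) * B
         + ?n y * (y - 0) ^ (2 * 1) * C + ?n y * \<bar>y - 0\<bar> ^ (2 * 1 + 1) * D)
      (fact (2 * 0) / ((2 / \<sigma>\<^sup>2) ^ 0 * fact 0) * A + 0 * B
         + fact (2 * 1) / ((2 / \<sigma>\<^sup>2) ^ 1 * fact 1) * C
         + 2 ^ 1 * \<sigma> ^ (2 * 1 + 1) * fact 1 * sqrt (2 / pi) * D)"
    by (intro has_bochner_integral_add has_bochner_integral_mult_left
        normal_moment_even normal_moment_odd normal_moment_abs_odd \<sigma>)
  also have "(\<lambda>y. ?n y * (y - 0) ^ (2 * 0) * A + ?n y * (y - 0) ^ (2 * 0 + 1) * B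
         + ?n y * (y - 0) ^ (2 * 1) * C + ?n y * \<bar>y - 0\<bar> ^ (2 * 1 + 1) * D)
      = (\<lambda>y. ?n y * (A + B * y + C * y\<^sup>2 + D * \<bar>y\<bar> ^ 3))"
    by (simp add: fun_eq_iff distrib_left eval_nat_numeral mult_ac)
  also have "fact (2 * 0) / ((2 / \<sigma>\<^sup>2) ^ 0 * fact 0) * A + 0 * B
         + fact (2 * 1) / ((2 / \<sigma>\<^sup>2) ^ 1 * fact 1) * C
         + 2 ^ 1 * \<sigma> ^ (2 * 1 + 1) * fact 1 * sqrt (2 / pi) * D
      = A + C * \<sigma>\<^sup>2 + D * (2 * \<sigma> ^ 3 * sqrt (2 / pi))"
    by simp
  finally have int: "has_bochner_integral lborel (\<lambda>y. ?n y * (A + B * y + C * y\<^sup>2 + D * \<bar>y\<bar> ^ 3))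
    (A + C * \<sigma>\<^sup>2 + D * (2 * \<sigma> ^ 3 * sqrt (2 / pi)))" .
  have "(\<integral>\<^sup>+y. ennreal (A + B * y + C * y\<^sup>2 + D * \<bar>y\<bar> ^ 3) \<partial>gaussian \<sigma>)
    = (\<integral>\<^sup>+y. ennreal (?n y * (A + B * y + C * y\<^sup>2 + D * \<bar>y\<bar> ^ 3)) \<partial>lborel)"
    by (subst nn_integral_density) (auto simp: ennreal_mult nonneg)
  also have "\<dots> = ennreal (\<integral>y. ?n y * (A + B * y + C * y\<^sup>2 + D * \<bar>y\<bar> ^ 3) \<partial>lborel)"
    using int by (intro nn_integral_eq_integral) (auto simp: nonneg has_bochner_integral_iff)
  finally show ?thesis using int by (simp add: has_bochner_integral_iff)
qed

lemma cube_add_le: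
  fixes u v :: real
  assumes "0 \<le> u" "0 \<le> v"
  shows "(u + v) ^ 3 \<le> 4 * (u ^ 3 + v ^ 3)"
proof -
  have "4 * (u ^ 3 + v ^ 3) - (u + v) ^ 3 = 3 * (u + v) * (u - v)\<^sup>2"
    by (simp add: power2_eq_square power3_eq_cube algebra_simps)
  also have "\<dots> \<ge> 0" using assms by simp
  finally show ?thesis by simp
qed

text \<open>The discrete counterpart of \<open>V' b + V'' / 2 + b\<^sup>2 = \<alpha>\<^sup>2\<close>. With increment \<open>d = b \<Delta> - y\<close>, where \<open>y\<close> is
centred with variance \<open>\<Delta>\<close>, the terms of order \<open>\<Delta>\<close> add up to \<open>\<alpha>\<^sup>2 \<Delta>\<close>, and the rest is of order
\<open>\<Delta> powr (3 / 2)\<close> uniformly in \<open>x\<close>, because the drift is bounded on \<open>[- a, a]\<close>.\<close>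

lemma potential_step:
  assumes "\<alpha> > 0" "0 < a" "\<alpha> * a < pi / 2"
  obtains D where "D \<ge> 0"
    "\<And>x \<Delta>. \<bar>x\<bar> \<le> a \<Longrightarrow> 0 < \<Delta> \<Longrightarrow> \<Delta> \<le> 1 \<Longrightarrow>
       (\<integral>\<^sup>+y. ennreal (potential \<alpha> a (x + drift \<alpha> x * \<Delta> - y)) \<partial>gaussian (sqrt \<Delta>))
         + ennreal ((drift \<alpha> x)\<^sup>2 * \<Delta>)
       \<le> ennreal (potential \<alpha> a x + (\<alpha>\<^sup>2 + D * sqrt \<Delta>) * \<Delta>)"
proof -
  obtain K where K: "K \<ge> 0" and taylor: "\<And>x d. \<bar>x\<bar> \<le> a \<Longrightarrow> potential \<alpha> a (x + d) \<le>
       potential \<alpha> a x - 2 * drift \<alpha> x * d + (\<alpha>\<^sup>2 + (drift \<alpha> x)\<^sup>2) * d\<^sup>2 + K * \<bar>d\<bar> ^ 3"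
    using potential_taylor[OF assms] by blast
  define B where "B = \<alpha> * tan (\<alpha> * a)"
  have B: "B \<ge> 0" using assms unfolding B_def by (intro mult_nonneg_nonneg less_imp_le[OF tan_gt_zero]) auto
  define D where "D = (\<alpha>\<^sup>2 + B\<^sup>2) * B\<^sup>2 + 4 * K * B ^ 3 + 4 * K * (2 * sqrt (2 / pi))"
  show thesis
  proof (rule that[of D])
    show "D \<ge> 0" using K B by (simp add: D_def)
    fix x \<Delta> :: real
    assume x: "\<bar>x\<bar> \<le> a" and \<Delta>: "0 < \<Delta>" "\<Delta> \<le> 1"
    define b C where "b = drift \<alpha> x" and "C = \<alpha>\<^sup>2 + b\<^sup>2"
    define s where "s = sqrt \<Delta>"
    have s: "0 < s" "s \<le> 1" "s\<^sup>2 = \<Delta>" using \<Delta> by (auto simp: s_def)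
    have bB: "\<bar>b\<bar> \<le> B" unfolding b_def drift_def B_def
      using abs_tan_le[OF assms(1,3) x] assms by (simp add: abs_mult)
    have C: "0 \<le> C" "C \<le> \<alpha>\<^sup>2 + B\<^sup>2" using bB by (auto simp: C_def abs_le_square_iff[symmetric])
    \<comment> \<open>The Taylor bound, expanded in powers of the Gaussian variable \<open>y\<close>.\<close>
    let ?P = "\<lambda>y. (potential \<alpha> a x - 2 * b\<^sup>2 * \<Delta> + C * b\<^sup>2 * \<Delta>\<^sup>2 + 4 * K * \<bar>b\<bar> ^ 3 * \<Delta> ^ 3)
        + (2 * b - 2 * C * b * \<Delta>) * y + C * y\<^sup>2 + (4 * K) * \<bar>y\<bar> ^ 3"
    have le: "potential \<alpha> a (x + b * \<Delta> - y) \<le> ?P y" for y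
    proof -
      have "potential \<alpha> a (x + b * \<Delta> - y) \<le>
          potential \<alpha> a x - 2 * b * (b * \<Delta> - y) + C * (b * \<Delta> - y)\<^sup>2 + K * \<bar>b * \<Delta> - y\<bar> ^ 3"
        using taylor[OF x, of "b * \<Delta> - y"] by (simp add: b_def C_def algebra_simps)
      moreover have "K * \<bar>b * \<Delta> - y\<bar> ^ 3 \<le> K * (4 * ((\<bar>b\<bar> * \<Delta>) ^ 3 + \<bar>y\<bar> ^ 3))"
      proof (intro mult_left_mono K)
        have "\<bar>b * \<Delta> - y\<bar> \<le> \<bar>b\<bar> * \<Delta> + \<bar>y\<bar>" using \<Delta> abs_triangle_ineq4[of "b * \<Delta>" y] by (simp add: abs_mult)
        then have "\<bar>b * \<Delta> - y\<bar> ^ 3 \<le> (\<bar>b\<bar> * \<Delta> + \<bar>y\<bar>) ^ 3" by (intro power_mono) auto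
        also have "\<dots> \<le> 4 * ((\<bar>b\<bar> * \<Delta>) ^ 3 + \<bar>y\<bar> ^ 3)" using \<Delta> by (intro cube_add_le) auto
        finally show "\<bar>b * \<Delta> - y\<bar> ^ 3 \<le> 4 * ((\<bar>b\<bar> * \<Delta>) ^ 3 + \<bar>y\<bar> ^ 3)" .
      qed
      ultimately show ?thesis
        by (simp add: power2_eq_square power_mult_distrib algebra_simps)
    qed
    have nonneg: "0 \<le> ?P y" for y
      using le[of y] potential_nonneg[of \<alpha> a "x + b * \<Delta> - y"] assms by linarith
    let ?I = "(potential \<alpha> a x - 2 * b\<^sup>2 * \<Delta> + C * b\<^sup>2 * \<Delta>\<^sup>2 + 4 * K * \<bar>b\<bar> ^ 3 * \<Delta> ^ 3)
        + C * s\<^sup>2 + (4 * K) * (2 * s ^ 3 * sqrt (2 / pi))"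
    have "(\<integral>\<^sup>+y. ennreal (potential \<alpha> a (x + b * \<Delta> - y)) \<partial>gaussian s) \<le> (\<integral>\<^sup>+y. ennreal (?P y) \<partial>gaussian s)"
      using le by (intro nn_integral_mono ennreal_leI)
    also have "\<dots> = ennreal ?I" using s nonneg by (intro gaussian_cubic_integral) auto
    finally have int: "(\<integral>\<^sup>+y. ennreal (potential \<alpha> a (x + b * \<Delta> - y)) \<partial>gaussian s) \<le> ennreal ?I" .
    have "?I + b\<^sup>2 * \<Delta> \<le> potential \<alpha> a x + (\<alpha>\<^sup>2 + D * s) * \<Delta>"
    proof -
      have ss: "\<Delta> ^ 2 \<le> s ^ 3" "\<Delta> ^ 3 \<le> s ^ 3"
        using s power_decreasing[of 3 4 s] power_decreasing[of 3 6 s]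
        by (auto simp: power_mult[symmetric] s(3)[symmetric])
      have "C * b\<^sup>2 * \<Delta>\<^sup>2 \<le> ((\<alpha>\<^sup>2 + B\<^sup>2) * B\<^sup>2) * s ^ 3"
        using C ss bB B by (intro mult_mono) (auto simp: abs_le_square_iff[symmetric])
      moreover have "4 * K * \<bar>b\<bar> ^ 3 * \<Delta> ^ 3 \<le> (4 * K * B ^ 3) * s ^ 3"
        using K ss bB B \<Delta> power_mono[of "\<bar>b\<bar>" B 3] by (intro mult_mono) auto
      moreover have "D * s * \<Delta> = D * s ^ 3" using s by (simp add: power2_eq_square power3_eq_cube)
      ultimately show ?thesis using s by (simp add: C_def D_def algebra_simps)
    qed
    moreover have "0 \<le> ?I"
    proof -
      have "0 \<le> ?P 0" by (rule nonneg)
      moreover have "0 \<le> C * s\<^sup>2 + (4 * K) * (2 * s ^ 3 * sqrt (2 / pi))"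
        using C K s pi_gt_zero by (intro add_nonneg_nonneg mult_nonneg_nonneg) auto
      ultimately show ?thesis by simp
    qed
    ultimately have "ennreal ?I + ennreal (b\<^sup>2 * \<Delta>) \<le> ennreal (potential \<alpha> a x + (\<alpha>\<^sup>2 + D * s) * \<Delta>)"
      using \<Delta> by (subst ennreal_plus[symmetric]) (auto intro!: ennreal_leI)
    then show "(\<integral>\<^sup>+y. ennreal (potential \<alpha> a (x + drift \<alpha> x * \<Delta> - y)) \<partial>gaussian (sqrt \<Delta>))
         + ennreal ((drift \<alpha> x)\<^sup>2 * \<Delta>)
       \<le> ennreal (potential \<alpha> a x + (\<alpha>\<^sup>2 + D * sqrt \<Delta>) * \<Delta>)"
      unfolding b_def[symmetric] s_def[symmetric] using int
      by (meson add_right_mono order_trans)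
  qed
qed

section \<open>The controlled random walk\<close>

text \<open>The values of \<open>h - W\<close> at the grid points, driven by the increments \<open>\<xi>\<close> of the path. Freezing the
walk outside \<open>[- a, a]\<close> lets its final position reveal whether it has ever left this interval.\<close>

primrec walk :: "real \<Rightarrow> real \<Rightarrow> real \<Rightarrow> (nat \<Rightarrow> real) \<Rightarrow> nat \<Rightarrow> real" where
  "walk \<alpha> a \<Delta> \<xi> 0 = 0"
| "walk \<alpha> a \<Delta> \<xi> (Suc k) =
     (if \<bar>walk \<alpha> a \<Delta> \<xi> k\<bar> \<le> a then walk \<alpha> a \<Delta> \<xi> k + drift \<alpha> (walk \<alpha> a \<Delta> \<xi> k) * \<Delta> - \<xi> k
      else walk \<alpha> a \<Delta> \<xi> k)"

definition walk_cost :: "real \<Rightarrow> real \<Rightarrow> real \<Rightarrow> (nat \<Rightarrow> real) \<Rightarrow> nat \<Rightarrow> real" where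
  "walk_cost \<alpha> a \<Delta> \<xi> m =
     (\<Sum>k<m. if \<bar>walk \<alpha> a \<Delta> \<xi> k\<bar> \<le> a then (drift \<alpha> (walk \<alpha> a \<Delta> \<xi> k))\<^sup>2 * \<Delta> else 0)"

lemma walk_cong: "(\<And>i. i < k \<Longrightarrow> \<xi> i = \<xi>' i) \<Longrightarrow> walk \<alpha> a \<Delta> \<xi> k = walk \<alpha> a \<Delta> \<xi>' k"
  by (induction k) auto

lemma walk_cost_cong: "(\<And>i. i < k \<Longrightarrow> \<xi> i = \<xi>' i) \<Longrightarrow> walk_cost \<alpha> a \<Delta> \<xi> k = walk_cost \<alpha> a \<Delta> \<xi>' k"
  unfolding walk_cost_def by (intro sum.cong refl) (use walk_cong[of _ \<xi> \<xi>' \<alpha> a \<Delta>] in auto)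

lemma walk_cost_nonneg: "0 \<le> \<Delta> \<Longrightarrow> 0 \<le> walk_cost \<alpha> a \<Delta> \<xi> m"
  unfolding walk_cost_def by (intro sum_nonneg) auto

lemma borel_measurable_walk [measurable (raw)]:
  assumes "\<And>i. i < k \<Longrightarrow> (\<lambda>\<omega>. \<xi> \<omega> i) \<in> borel_measurable N"
  shows "(\<lambda>\<omega>. walk \<alpha> a \<Delta> (\<xi> \<omega>) k) \<in> borel_measurable N"
  using assms
proof (induction k)
  case (Suc k)
  have [measurable]: "(\<lambda>\<omega>. walk \<alpha> a \<Delta> (\<xi> \<omega>) k) \<in> borel_measurable N" "(\<lambda>\<omega>. \<xi> \<omega> k) \<in> borel_measurable N"
    using Suc by auto
  show ?case by simp
qed simp

lemma borel_measurable_walk_cost [measurable (raw)]: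
  assumes "\<And>i. i < k \<Longrightarrow> (\<lambda>\<omega>. \<xi> \<omega> i) \<in> borel_measurable N"
  shows "(\<lambda>\<omega>. walk_cost \<alpha> a \<Delta> (\<xi> \<omega>) k) \<in> borel_measurable N"
  unfolding walk_cost_def
proof (rule borel_measurable_sum)
  fix j assume "j \<in> {..<k}"
  then have [measurable]: "(\<lambda>\<omega>. walk \<alpha> a \<Delta> (\<xi> \<omega>) j) \<in> borel_measurable N"
    using assms by (intro borel_measurable_walk) auto
  show "(\<lambda>\<omega>. if \<bar>walk \<alpha> a \<Delta> (\<xi> \<omega>) j\<bar> \<le> a then (drift \<alpha> (walk \<alpha> a \<Delta> (\<xi> \<omega>) j))\<^sup>2 * \<Delta> else 0) \<in> borel_measurable N"
    by measurable
qed

text \<open>The potential plus the accumulated cost, compensated by \<open>c\<close> per step, is a supermartingale. The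
product measure splits off the last increment, on which neither the previous position nor the
previous cost depends.\<close>

lemma walk_expected_cost:
  assumes step: "\<And>x. \<bar>x\<bar> \<le> a \<Longrightarrow>
       (\<integral>\<^sup>+y. ennreal (potential \<alpha> a (x + drift \<alpha> x * \<Delta> - y)) \<partial>gaussian \<sigma>)
         + ennreal ((drift \<alpha> x)\<^sup>2 * \<Delta>) \<le> ennreal (potential \<alpha> a x + c)"
    and \<alpha>: "\<alpha> > 0" "0 < a" "\<alpha> * a < pi / 2"
    and \<sigma>: "\<sigma> > 0" and \<Delta>: "0 \<le> \<Delta>" and c: "c \<ge> 0"
  shows "(\<integral>\<^sup>+\<xi>. ennreal (potential \<alpha> a (walk \<alpha> a \<Delta> \<xi> m)) + ennreal (walk_cost \<alpha> a \<Delta> \<xi> m)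
           \<partial>PiM {..<m} (\<lambda>_. gaussian \<sigma>)) \<le> ennreal (real m * c)"
proof -
  interpret G: prob_space "gaussian \<sigma>" by (rule prob_space_normal_density[OF \<sigma>])
  interpret P: product_prob_space "\<lambda>_::nat. gaussian \<sigma>" by standard
  let ?F = "\<lambda>m \<xi>. ennreal (potential \<alpha> a (walk \<alpha> a \<Delta> \<xi> m)) + ennreal (walk_cost \<alpha> a \<Delta> \<xi> m)"
  have meas: "?F m \<in> borel_measurable (PiM {..<m} (\<lambda>_. gaussian \<sigma>))" for m
  proof -
    have [measurable]: "(\<lambda>\<xi>. \<xi> i) \<in> borel_measurable (PiM {..<m} (\<lambda>_. gaussian \<sigma>))" if "i < m" for i
      using measurable_component_singleton[of i "{..<m}" "\<lambda>_. gaussian \<sigma>"] that by simp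
    have [measurable]: "(\<lambda>\<xi>. walk \<alpha> a \<Delta> \<xi> m) \<in> borel_measurable (PiM {..<m} (\<lambda>_. gaussian \<sigma>))"
       "(\<lambda>\<xi>. walk_cost \<alpha> a \<Delta> \<xi> m) \<in> borel_measurable (PiM {..<m} (\<lambda>_. gaussian \<sigma>))"
      by (auto intro!: borel_measurable_walk borel_measurable_walk_cost)
    show ?thesis by measurable
  qed
  show ?thesis
  proof (induction m)
    case 0
    have "?F 0 = (\<lambda>_. 0)" using \<alpha> by (auto simp: potential_def walk_cost_def)
    then show ?case by simp
  next
    case (Suc m)
    have step': "(\<integral>\<^sup>+y. ?F (Suc m) (\<xi>(m := y)) \<partial>gaussian \<sigma>) \<le> ?F m \<xi> + ennreal c" for \<xi>
    proof -
      define x q where "x = walk \<alpha> a \<Delta> \<xi> m" and "q = walk_cost \<alpha> a \<Delta> \<xi> m"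
      have q: "q \<ge> 0" by (simp add: q_def walk_cost_nonneg \<Delta>)
      have [simp]: "walk \<alpha> a \<Delta> (\<xi>(m := y)) m = x" "walk_cost \<alpha> a \<Delta> (\<xi>(m := y)) m = q" for y
        unfolding x_def q_def by (auto intro!: walk_cong walk_cost_cong)
      have cost: "walk_cost \<alpha> a \<Delta> (\<xi>(m := y)) (Suc m)
          = q + (if \<bar>x\<bar> \<le> a then (drift \<alpha> x)\<^sup>2 * \<Delta> else 0)" for y
      proof -
        have "walk_cost \<alpha> a \<Delta> (\<xi>(m := y)) (Suc m)
          = walk_cost \<alpha> a \<Delta> (\<xi>(m := y)) m + (if \<bar>walk \<alpha> a \<Delta> (\<xi>(m := y)) m\<bar> \<le> a
              then (drift \<alpha> (walk \<alpha> a \<Delta> (\<xi>(m := y)) m))\<^sup>2 * \<Delta> else 0)"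
          unfolding walk_cost_def by (simp only: sum.lessThan_Suc)
        then show ?thesis by simp
      qed
      have p: "potential \<alpha> a x \<ge> 0" using potential_nonneg \<alpha> by simp
      show ?thesis
      proof (cases "\<bar>x\<bar> \<le> a")
        case True
        have "(\<integral>\<^sup>+y. ?F (Suc m) (\<xi>(m := y)) \<partial>gaussian \<sigma>)
          = (\<integral>\<^sup>+y. ennreal (potential \<alpha> a (x + drift \<alpha> x * \<Delta> - y)) + ennreal (q + (drift \<alpha> x)\<^sup>2 * \<Delta>) \<partial>gaussian \<sigma>)"
          using True cost by simp
        also have "\<dots> = (\<integral>\<^sup>+y. ennreal (potential \<alpha> a (x + drift \<alpha> x * \<Delta> - y)) \<partial>gaussian \<sigma>)
            + ennreal (q + (drift \<alpha> x)\<^sup>2 * \<Delta>)"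
          using G.emeasure_space_1 by (subst nn_integral_add) auto
        also have "\<dots> = ((\<integral>\<^sup>+y. ennreal (potential \<alpha> a (x + drift \<alpha> x * \<Delta> - y)) \<partial>gaussian \<sigma>)
            + ennreal ((drift \<alpha> x)\<^sup>2 * \<Delta>)) + ennreal q"
          using q \<Delta> by (simp add: ennreal_plus ac_simps)
        also have "\<dots> \<le> ennreal (potential \<alpha> a x + c) + ennreal q"
          by (intro add_right_mono step True)
        finally show ?thesis using p c by (simp add: x_def[symmetric] q_def[symmetric] ennreal_plus ac_simps)
      next
        case False
        then have "(\<integral>\<^sup>+y. ?F (Suc m) (\<xi>(m := y)) \<partial>gaussian \<sigma>) = ?F m \<xi>"
          using cost G.emeasure_space_1 by (simp add: x_def[symmetric] q_def[symmetric])
        then show ?thesis by simp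
      qed
    qed
    have "(\<integral>\<^sup>+\<xi>. ?F (Suc m) \<xi> \<partial>PiM {..<Suc m} (\<lambda>_. gaussian \<sigma>))
      = (\<integral>\<^sup>+\<xi>. (\<integral>\<^sup>+y. ?F (Suc m) (\<xi>(m := y)) \<partial>gaussian \<sigma>) \<partial>PiM {..<m} (\<lambda>_. gaussian \<sigma>))"
      using meas[of "Suc m"] unfolding lessThan_Suc
      by (intro P.product_nn_integral_insert) auto
    also have "\<dots> \<le> (\<integral>\<^sup>+\<xi>. ?F m \<xi> + ennreal c \<partial>PiM {..<m} (\<lambda>_. gaussian \<sigma>))"
      by (intro nn_integral_mono step')
    also have "\<dots> = (\<integral>\<^sup>+\<xi>. ?F m \<xi> \<partial>PiM {..<m} (\<lambda>_. gaussian \<sigma>)) + ennreal c"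
      using meas[of m] prob_space.emeasure_space_1[OF prob_space_PiM[of "{..<m}" "\<lambda>_. gaussian \<sigma>"]] G.prob_space_axioms
      by (subst nn_integral_add) auto
    also have "\<dots> \<le> ennreal (real m * c) + ennreal c"
      by (intro add_right_mono Suc)
    also have "\<dots> = ennreal (real (Suc m) * c)"
      using c by (simp add: ennreal_plus[symmetric] algebra_simps del: ennreal_plus)
    finally show ?case .
  qed
qed
section \<open>Piecewise linear competitors\<close>

text \<open>The piecewise linear function with slope \<open>\<beta> k\<close> on the \<open>k\<close>-th cell. As a sum of ramps it is defined on
the whole line and Lipschitz without any gluing.\<close>

definition polygon :: "real \<Rightarrow> nat \<Rightarrow> (nat \<Rightarrow> real) \<Rightarrow> real \<Rightarrow> real" where
  "polygon \<Delta> m \<beta> t = (\<Sum>k<m. \<beta> k * max 0 (min (t - real k * \<Delta>) \<Delta>))"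

lemma polygon_cell:
  assumes "0 \<le> \<Delta>" "k < m" "real k * \<Delta> \<le> t" "t \<le> real (Suc k) * \<Delta>"
  shows "polygon \<Delta> m \<beta> t = (\<Sum>j<k. \<beta> j * \<Delta>) + \<beta> k * (t - real k * \<Delta>)"
proof -
  have split: "{..<m} = {..<k} \<union> {k} \<union> {Suc k..<m}" using assms by auto
  have "polygon \<Delta> m \<beta> t = (\<Sum>j<k. \<beta> j * max 0 (min (t - real j * \<Delta>) \<Delta>))
     + \<beta> k * max 0 (min (t - real k * \<Delta>) \<Delta>)
     + (\<Sum>j\<in>{Suc k..<m}. \<beta> j * max 0 (min (t - real j * \<Delta>) \<Delta>))"
    unfolding polygon_def split
    by (subst sum.union_disjoint, simp, simp, force, subst sum.union_disjoint) auto
  also have "(\<Sum>j<k. \<beta> j * max 0 (min (t - real j * \<Delta>) \<Delta>)) = (\<Sum>j<k. \<beta> j * \<Delta>)"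
  proof (rule sum.cong)
    fix j assume "j \<in> {..<k}"
    then have "real (Suc j) * \<Delta> \<le> real k * \<Delta>" using assms by (intro mult_right_mono) auto
    then have "\<Delta> \<le> t - real j * \<Delta>" using assms by (simp add: algebra_simps)
    then show "\<beta> j * max 0 (min (t - real j * \<Delta>) \<Delta>) = \<beta> j * \<Delta>" using assms by simp
  qed simp
  also have "(\<Sum>j\<in>{Suc k..<m}. \<beta> j * max 0 (min (t - real j * \<Delta>) \<Delta>)) = 0"
  proof (rule sum.neutral, rule ballI)
    fix j assume "j \<in> {Suc k..<m}"
    then have "real (Suc k) * \<Delta> \<le> real j * \<Delta>" using assms by (intro mult_right_mono) auto
    then have "t - real j * \<Delta> \<le> 0" using assms by simp
    then show "\<beta> j * max 0 (min (t - real j * \<Delta>) \<Delta>) = 0" using assms by simp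
  qed
  also have "max 0 (min (t - real k * \<Delta>) \<Delta>) = t - real k * \<Delta>"
    using assms by (simp add: algebra_simps)
  finally show ?thesis by simp
qed

lemma polygon_0: "0 \<le> \<Delta> \<Longrightarrow> polygon \<Delta> m \<beta> 0 = 0"
  unfolding polygon_def
proof (intro sum.neutral ballI)
  fix k assume "0 \<le> \<Delta>"
  then have "min (0 - real k * \<Delta>) \<Delta> \<le> 0" by (simp add: min_le_iff_disj)
  then show "\<beta> k * max 0 (min (0 - real k * \<Delta>) \<Delta>) = 0" by simp
qed

lemma lipschitz_imp_absolutely_continuous_on:
  assumes "0 \<le> L" "\<And>s t. \<bar>f s - f t\<bar> \<le> L * \<bar>s - t\<bar>"
  shows "absolutely_continuous_on S f"
  unfolding absolutely_continuous_on_def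
proof (intro allI impI)
  fix \<epsilon> :: real assume \<epsilon>: "\<epsilon> > 0"
  show "\<exists>\<delta>>0. \<forall>(n::nat) a b.
        (\<forall>i<n. a i \<le> b i \<and> {a i..b i} \<subseteq> S) \<and>
        disjoint_family_on (\<lambda>i. {a i<..<b i}) {..<n} \<and>
        (\<Sum>i<n. b i - a i) < \<delta> \<longrightarrow>
        (\<Sum>i<n. \<bar>f (b i) - f (a i)\<bar>) < \<epsilon>"
  proof (intro exI[of _ "\<epsilon> / (L + 1)"] conjI allI impI)
    show "0 < \<epsilon> / (L + 1)" using \<epsilon> assms by simp
    fix n :: nat and a b :: "nat \<Rightarrow> real"
    assume A: "(\<forall>i<n. a i \<le> b i \<and> {a i..b i} \<subseteq> S) \<and>
        disjoint_family_on (\<lambda>i. {a i<..<b i}) {..<n} \<and> (\<Sum>i<n. b i - a i) < \<epsilon> / (L + 1)"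
    have "(\<Sum>i<n. \<bar>f (b i) - f (a i)\<bar>) \<le> (\<Sum>i<n. L * (b i - a i))"
    proof (rule sum_mono)
      fix i assume "i \<in> {..<n}"
      then have "a i \<le> b i" using A by auto
      then show "\<bar>f (b i) - f (a i)\<bar> \<le> L * (b i - a i)" using assms(2)[of "b i" "a i"] by simp
    qed
    also have "\<dots> = L * (\<Sum>i<n. b i - a i)" by (simp add: sum_distrib_left)
    also have "\<dots> \<le> L * (\<epsilon> / (L + 1))" using A assms by (intro mult_left_mono) auto
    also have "\<dots> < \<epsilon>" using \<epsilon> assms by (simp add: field_simps)
    finally show "(\<Sum>i<n. \<bar>f (b i) - f (a i)\<bar>) < \<epsilon>" .
  qed
qed

lemma absolutely_continuous_on_polygon: "absolutely_continuous_on S (polygon \<Delta> m \<beta>)"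
proof (rule lipschitz_imp_absolutely_continuous_on)
  show "0 \<le> (\<Sum>k<m. \<bar>\<beta> k\<bar>)" by (simp add: sum_nonneg)
  fix s t
  have "\<bar>polygon \<Delta> m \<beta> s - polygon \<Delta> m \<beta> t\<bar>
      = \<bar>\<Sum>k<m. \<beta> k * (max 0 (min (s - real k * \<Delta>) \<Delta>) - max 0 (min (t - real k * \<Delta>) \<Delta>))\<bar>"
    by (simp add: polygon_def sum_subtractf right_diff_distrib)
  also have "\<dots> \<le> (\<Sum>k<m. \<bar>\<beta> k * (max 0 (min (s - real k * \<Delta>) \<Delta>) - max 0 (min (t - real k * \<Delta>) \<Delta>))\<bar>)"
    by (rule sum_abs)
  also have "\<dots> \<le> (\<Sum>k<m. \<bar>\<beta> k\<bar> * \<bar>s - t\<bar>)"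
    unfolding abs_mult by (intro sum_mono mult_left_mono) auto
  finally show "\<bar>polygon \<Delta> m \<beta> s - polygon \<Delta> m \<beta> t\<bar> \<le> (\<Sum>k<m. \<bar>\<beta> k\<bar>) * \<bar>s - t\<bar>"
    by (simp add: sum_distrib_right)
qed

lemma cell_of_unit_interval:
  assumes "m > 0" "t \<in> {0..1}"
  obtains k where "k < m" "real k * (1 / real m) \<le> t" "t \<le> real (Suc k) * (1 / real m)"
proof -
  define k where "k = nat \<lfloor>t * real m\<rfloor>"
  have k: "real k \<le> t * real m" "t * real m < real (Suc k)"
    using assms unfolding k_def by (auto simp: of_nat_nat) linarith+
  show thesis
  proof (cases "t = 1")
    case True
    show thesis by (rule that[of "m - 1"]) (use assms True in \<open>auto simp: field_simps of_nat_diff\<close>)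
  next
    case False
    then have "t * real m < 1 * real m" using assms by (intro mult_strict_right_mono) auto
    then have "k < m" using k by linarith
    with k assms show thesis by (intro that[of k]) (auto simp: field_simps)
  qed
qed

text \<open>Only an inequality is claimed: the derivative at grid points is arbitrary, and the closed cells
overlap there, both on a null set.\<close>

lemma polygon_energy:
  assumes m: "m > 0"
  shows "energy_norm (polygon (1 / real m) m \<beta>) \<le> ennreal (sqrt (\<Sum>k<m. (\<beta> k)\<^sup>2 * (1 / real m)))"
proof -
  define \<Delta> where "\<Delta> = 1 / real m"
  have \<Delta>: "\<Delta> > 0" using m by (simp add: \<Delta>_def)
  let ?h = "polygon \<Delta> m \<beta>" and ?S = "\<Sum>k<m. (\<beta> k)\<^sup>2 * \<Delta>"
  let ?cell = "\<lambda>k. {real k * \<Delta>..real (Suc k) * \<Delta>}"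
  define E where "E = (\<integral>\<^sup>+t\<in>{0..1}. ennreal ((deriv ?h t)\<^sup>2) \<partial>lborel)"
  have der: "deriv ?h t = \<beta> k" if k: "k < m" and t: "real k * \<Delta> < t" "t < real (Suc k) * \<Delta>" for k t
  proof (rule DERIV_imp_deriv)
    have "((\<lambda>t. (\<Sum>j<k. \<beta> j * \<Delta>) + \<beta> k * (t - real k * \<Delta>)) has_field_derivative \<beta> k) (at t)"
      by (auto intro!: derivative_eq_intros)
    then show "(?h has_field_derivative \<beta> k) (at t)"
    proof (rule has_field_derivative_transform_within_open)
      show "open {real k * \<Delta><..<real (Suc k) * \<Delta>}" "t \<in> {real k * \<Delta><..<real (Suc k) * \<Delta>}"
        using t by auto
      show "(\<Sum>j<k. \<beta> j * \<Delta>) + \<beta> k * (u - real k * \<Delta>) = ?h u"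
        if "u \<in> {real k * \<Delta><..<real (Suc k) * \<Delta>}" for u
        using polygon_cell[of \<Delta> k m u \<beta>] that k \<Delta> by simp
    qed
  qed
  have "AE t in lborel. t \<notin> (\<lambda>k. real k * \<Delta>) ` {..m}"
    by (intro AE_not_in finite_imp_null_set_lborel) auto
  then have "AE t in lborel. ennreal ((deriv ?h t)\<^sup>2) * indicator {0..1} t
       \<le> (\<Sum>k<m. ennreal ((\<beta> k)\<^sup>2) * indicator (?cell k) t)"
  proof eventually_elim
    case (elim t)
    show ?case
    proof (cases "t \<in> {0..1}")
      case True
      obtain k where k: "k < m" "real k * \<Delta> \<le> t" "t \<le> real (Suc k) * \<Delta>"
        using cell_of_unit_interval[OF m True] unfolding \<Delta>_def by blast
      have "t \<noteq> real k * \<Delta>" using elim k by auto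
      moreover have "t \<noteq> real (Suc k) * \<Delta>" using elim k by (metis Suc_leI atMost_iff image_eqI)
      ultimately have "deriv ?h t = \<beta> k" using k by (intro der) auto
      then have "ennreal ((deriv ?h t)\<^sup>2) * indicator {0..1} t = ennreal ((\<beta> k)\<^sup>2) * indicator (?cell k) t"
        using True k by simp
      also have "\<dots> \<le> (\<Sum>k<m. ennreal ((\<beta> k)\<^sup>2) * indicator (?cell k) t)"
        using k by (intro member_le_sum) auto
      finally show ?thesis .
    qed simp
  qed
  then have "E \<le> (\<integral>\<^sup>+t. (\<Sum>k<m. ennreal ((\<beta> k)\<^sup>2) * indicator (?cell k) t) \<partial>lborel)"
    unfolding E_def by (rule nn_integral_mono_AE)
  also have "\<dots> = (\<Sum>k<m. ennreal ((\<beta> k)\<^sup>2) * emeasure lborel (?cell k))"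
    by (subst nn_integral_sum) (auto simp: nn_integral_cmult_indicator)
  also have "\<dots> = (\<Sum>k<m. ennreal ((\<beta> k)\<^sup>2 * \<Delta>))"
    using \<Delta> by (intro sum.cong) (auto simp: ennreal_mult algebra_simps)
  also have "\<dots> = ennreal ?S" using \<Delta> by (intro sum_ennreal) auto
  finally have E: "E \<le> ennreal ?S" .
  then have fin: "E \<noteq> \<infinity>" by (auto simp: top_unique)
  have S: "0 \<le> ?S" using \<Delta> by (intro sum_nonneg) auto
  have "enn2real E \<le> ?S" using E S by (metis enn2real_ennreal enn2real_mono ennreal_less_top)
  then have "energy_norm ?h \<le> ennreal (sqrt ?S)"
    using fin by (simp add: energy_norm_def E_def[symmetric] ennreal_leI)
  then show ?thesis by (simp add: \<Delta>_def)
qed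

lemma taut_string_energy_le_polygon:
  assumes m: "m > 0"
    and close: "\<And>k t. k < m \<Longrightarrow> real k * (1 / real m) \<le> t \<Longrightarrow> t \<le> real (Suc k) * (1 / real m) \<Longrightarrow>
      \<bar>(\<Sum>j<k. \<beta> j * (1 / real m)) + \<beta> k * (t - real k * (1 / real m)) - w t\<bar> \<le> \<epsilon>"
  shows "taut_string_energy w \<epsilon> \<le> ennreal (sqrt (\<Sum>k<m. (\<beta> k)\<^sup>2 * (1 / real m)))"
proof -
  let ?h = "polygon (1 / real m) m \<beta>"
  have "(SUP t\<in>{0..1}. ennreal \<bar>?h t - w t\<bar>) \<le> ennreal \<epsilon>"
  proof (rule SUP_least)
    fix t :: real assume "t \<in> {0..1}"
    then obtain k where k: "k < m" "real k * (1 / real m) \<le> t" "t \<le> real (Suc k) * (1 / real m)"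
      using cell_of_unit_interval[OF m] by blast
    have "?h t = (\<Sum>j<k. \<beta> j * (1 / real m)) + \<beta> k * (t - real k * (1 / real m))"
      by (rule polygon_cell) (use k in auto)
    then show "ennreal \<bar>?h t - w t\<bar> \<le> ennreal \<epsilon>"
      using close[OF k] by (intro ennreal_leI) simp
  qed
  then have "taut_string_energy w \<epsilon> \<le> energy_norm ?h"
    unfolding taut_string_energy_def
    by (intro INF_lower) (simp add: absolutely_continuous_on_polygon polygon_0)
  also note polygon_energy[OF m]
  finally show ?thesis .
qed

lemma walk_frozen:
  assumes "\<bar>walk \<alpha> a \<Delta> \<xi> m\<bar> \<le> a" "k \<le> m"
  shows "\<bar>walk \<alpha> a \<Delta> \<xi> k\<bar> \<le> a"
proof (rule ccontr)
  assume out: "\<not> \<bar>walk \<alpha> a \<Delta> \<xi> k\<bar> \<le> a"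
  have "walk \<alpha> a \<Delta> \<xi> (k + n) = walk \<alpha> a \<Delta> \<xi> k" for n
    using out by (induction n) auto
  then show False using assms out by (metis le_add_diff_inverse)
qed

text \<open>This identifies the walk with \<open>h - W\<close> at the grid points, the right-hand side being \<open>h\<close>.\<close>

lemma walk_pursues:
  assumes w0: "w 0 = 0" and in_m: "\<bar>walk \<alpha> a \<Delta> \<xi> m\<bar> \<le> a"
    and \<xi>: "\<And>k. k < m \<Longrightarrow> \<xi> k = w (real (Suc k) * \<Delta>) - w (real k * \<Delta>)"
    and "k \<le> m"
  shows "walk \<alpha> a \<Delta> \<xi> k + w (real k * \<Delta>) = (\<Sum>j<k. drift \<alpha> (walk \<alpha> a \<Delta> \<xi> j) * \<Delta>)"
  using \<open>k \<le> m\<close>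
proof (induction k)
  case 0
  then show ?case using w0 by simp
next
  case (Suc k)
  have "\<bar>walk \<alpha> a \<Delta> \<xi> k\<bar> \<le> a" using walk_frozen[OF in_m] Suc by simp
  then show ?case using Suc \<xi>[of k] by simp
qed

text \<open>Inside a cell the distance between polygon and path exceeds \<open>\<bar>X k\<bar> \<le> a\<close> by at most the movement of the
polygon, with slope bounded by \<open>\<alpha> tan (\<alpha> a)\<close>, and the oscillation of the path.\<close>

lemma taut_string_energy_le_walk_cost:
  assumes m: "m > 0" and \<alpha>: "\<alpha> > 0" "0 < a" "\<alpha> * a < pi / 2"
    and w0: "w 0 = 0"
    and in_m: "\<bar>walk \<alpha> a (1 / real m) \<xi> m\<bar> \<le> a"
    and \<xi>: "\<And>k. k < m \<Longrightarrow> \<xi> k = w (real (Suc k) * (1 / real m)) - w (real k * (1 / real m))"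
    and osc: "\<And>s t. s \<in> {0..1} \<Longrightarrow> t \<in> {0..1} \<Longrightarrow> \<bar>s - t\<bar> \<le> 1 / real m \<Longrightarrow> \<bar>w s - w t\<bar> \<le> r"
    and small: "a + \<alpha> * tan (\<alpha> * a) / m + r \<le> \<epsilon>"
  shows "taut_string_energy w \<epsilon> \<le> ennreal (sqrt (walk_cost \<alpha> a (1 / real m) \<xi> m))"
proof -
  let ?X = "walk \<alpha> a (1 / real m) \<xi>"
  let ?\<beta> = "\<lambda>k. drift \<alpha> (?X k)"
  have bounded: "\<bar>?X k\<bar> \<le> a" if "k \<le> m" for k using walk_frozen[OF in_m that] .
  have "taut_string_energy w \<epsilon> \<le> ennreal (sqrt (\<Sum>k<m. (?\<beta> k)\<^sup>2 * (1 / real m)))"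
  proof (rule taut_string_energy_le_polygon[OF m])
    fix k t assume k: "k < m" "real k * (1 / real m) \<le> t" "t \<le> real (Suc k) * (1 / real m)"
    let ?s = "real k * (1 / real m)"
    have "(\<Sum>j<k. ?\<beta> j * (1 / real m)) + ?\<beta> k * (t - ?s) - w t = ?X k + ?\<beta> k * (t - ?s) + (w ?s - w t)"
      using walk_pursues[of w \<alpha> a "1 / real m" \<xi> m k, OF w0 in_m \<xi>] k by simp
    also have "\<bar>\<dots>\<bar> \<le> \<bar>?X k\<bar> + \<bar>?\<beta> k * (t - ?s)\<bar> + \<bar>w ?s - w t\<bar>" by linarith
    also have "\<dots> \<le> a + \<alpha> * tan (\<alpha> * a) / m + r"
    proof (intro add_mono)
      show "\<bar>?X k\<bar> \<le> a" using bounded k by simp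
      have ts: "0 \<le> t - ?s" "t - ?s \<le> 1 / real m" using k by (auto simp: add_divide_distrib)
      have "\<bar>?\<beta> k\<bar> \<le> \<alpha> * tan (\<alpha> * a)"
        using abs_tan_le[OF \<alpha>(1,3) bounded[of k]] k \<alpha> by (simp add: drift_def abs_mult)
      then have "\<bar>?\<beta> k\<bar> * (t - ?s) \<le> \<alpha> * tan (\<alpha> * a) * (1 / real m)"
        using ts by (intro mult_mono) auto
      then show "\<bar>?\<beta> k * (t - ?s)\<bar> \<le> \<alpha> * tan (\<alpha> * a) / m" using ts by (simp add: abs_mult)
      have "real (Suc k) * (1 / real m) \<le> 1" using k m by (simp add: field_simps)
      then have "t \<le> 1" using k by linarith
      moreover have "0 \<le> ?s" by simp
      ultimately have "?s \<in> {0..1}" "t \<in> {0..1}" "\<bar>?s - t\<bar> \<le> 1 / real m"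
        using ts unfolding atLeastAtMost_iff by linarith+
      then show "\<bar>w ?s - w t\<bar> \<le> r" by (rule osc)
    qed
    finally show "\<bar>(\<Sum>j<k. ?\<beta> j * (1 / real m)) + ?\<beta> k * (t - ?s) - w t\<bar> \<le> \<epsilon>" using small by linarith
  qed
  also have "(\<Sum>k<m. (?\<beta> k)\<^sup>2 * (1 / real m)) = walk_cost \<alpha> a (1 / real m) \<xi> m"
    unfolding walk_cost_def using bounded by (intro sum.cong) auto
  finally show ?thesis .
qed
section \<open>Events of small oscillation\<close>

lemma rational_approximation:
  assumes "s \<in> {0..1::real}"
  obtains q where "\<And>i::nat. q i \<in> \<rat> \<inter> {0..1}" "q \<longlonglongrightarrow> s"
proof (rule that)
  let ?q = "\<lambda>i::nat. of_int \<lfloor>s * real (Suc i)\<rfloor> / real (Suc i)"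
  have upper: "?q i \<le> s" for i by (simp add: field_simps del: of_nat_Suc)
  have lower: "s - 1 / real (Suc i) \<le> ?q i" for i
  proof -
    have "s * real (Suc i) - 1 \<le> of_int \<lfloor>s * real (Suc i)\<rfloor>" by linarith
    then have "(s * real (Suc i) - 1) / real (Suc i) \<le> ?q i" by (intro divide_right_mono) auto
    then show ?thesis by (simp add: diff_divide_distrib del: of_nat_Suc)
  qed
  show "?q i \<in> \<rat> \<inter> {0..1}" for i
  proof -
    have "0 \<le> ?q i" using assms by simp
    moreover have "?q i \<le> 1" by (rule order_trans[OF upper[of i]]) (use assms in simp)
    ultimately show ?thesis by simp
  qed
  have "(\<lambda>i. s - 1 / real (Suc i)) \<longlonglongrightarrow> s - 0"
    by (intro tendsto_diff tendsto_const LIMSEQ_Suc[OF lim_1_over_n])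
  then show "?q \<longlonglongrightarrow> s"
    by (intro tendsto_sandwich[of "\<lambda>i. s - 1 / real (Suc i)" ?q sequentially "\<lambda>_. s"])
       (use lower upper in auto)
qed

lemma oscillation_extends_from_rationals:
  fixes w :: "real \<Rightarrow> real"
  assumes cont: "continuous_on {0..1} w"
    and rat: "\<And>s t. s \<in> \<rat> \<inter> {0..1} \<Longrightarrow> t \<in> \<rat> \<inter> {0..1} \<Longrightarrow> \<bar>s - t\<bar> < \<delta> \<Longrightarrow> \<bar>w s - w t\<bar> \<le> r"
    and st: "s \<in> {0..1}" "t \<in> {0..1}" "\<bar>s - t\<bar> < \<delta>"
  shows "\<bar>w s - w t\<bar> \<le> r"
proof -
  obtain p where p: "\<And>i::nat. p i \<in> \<rat> \<inter> {0..1}" "p \<longlonglongrightarrow> s" using rational_approximation[OF st(1)] by blast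
  obtain q where q: "\<And>i::nat. q i \<in> \<rat> \<inter> {0..1}" "q \<longlonglongrightarrow> t" using rational_approximation[OF st(2)] by blast
  have "(\<lambda>i. w (p i)) \<longlonglongrightarrow> w s"
    using p by (intro continuous_on_tendsto_compose[OF cont _ st(1)]) auto
  moreover have "(\<lambda>i. w (q i)) \<longlonglongrightarrow> w t"
    using q by (intro continuous_on_tendsto_compose[OF cont _ st(2)]) auto
  ultimately have lim: "(\<lambda>i. \<bar>w (p i) - w (q i)\<bar>) \<longlonglongrightarrow> \<bar>w s - w t\<bar>"
    by (intro tendsto_rabs tendsto_diff)
  have "(\<lambda>i. \<bar>p i - q i\<bar>) \<longlonglongrightarrow> \<bar>s - t\<bar>"
    using p q by (intro tendsto_rabs tendsto_diff)
  then have "\<forall>\<^sub>F i in sequentially. \<bar>p i - q i\<bar> < \<delta>" using st(3) by (rule order_tendstoD)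
  then have "\<forall>\<^sub>F i in sequentially. \<bar>w (p i) - w (q i)\<bar> \<le> r"
    by eventually_elim (use rat p q in blast)
  then show ?thesis by (intro tendsto_upperbound[OF lim]) auto
qed

text \<open>The convergence is a consequence of the uniform continuity of almost every path. The
events restrict the oscillation at rational times only, which makes them measurable.\<close>

lemma (in prob_space) small_oscillation_events:
  fixes W :: "real \<Rightarrow> 'a \<Rightarrow> real"
  assumes meas: "\<And>t. t \<in> {0..1} \<Longrightarrow> W t \<in> borel_measurable M"
    and cont: "AE \<omega> in M. continuous_on {0..1} (\<lambda>t. W t \<omega>)" and r: "r > 0"
  obtains S where "\<And>n::nat. S n \<in> sets M" "(\<lambda>n. prob (S n)) \<longlonglongrightarrow> 1"
    "AE \<omega> in M. \<forall>n. \<omega> \<in> S n \<longrightarrow>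
       (\<forall>s\<in>{0..1}. \<forall>t\<in>{0..1}. \<bar>s - t\<bar> \<le> 1 / real (Suc n) \<longrightarrow> \<bar>W s \<omega> - W t \<omega>\<bar> \<le> r)"
proof -
  \<comment> \<open>The bound \<open>2 / Suc n\<close> leaves room to approximate a pair at distance exactly \<open>1 / Suc n\<close>.\<close>
  define Q where "Q n = {(s, t). s \<in> \<rat> \<inter> {0..1::real} \<and> t \<in> \<rat> \<inter> {0..1::real} \<and> \<bar>s - t\<bar> < 2 / real (Suc n)}" for n
  define S where "S n = (\<Inter>p\<in>Q n. {\<omega> \<in> space M. \<bar>W (fst p) \<omega> - W (snd p) \<omega>\<bar> \<le> r})" for n
  have Q0: "(0, 0) \<in> Q n" for n by (simp add: Q_def)
  have sets: "S n \<in> sets M" for n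
    unfolding S_def
  proof (rule sets.countable_INT')
    have "Q n \<subseteq> \<rat> \<times> \<rat>" by (auto simp: Q_def)
    moreover have "countable (\<rat> \<times> \<rat> :: (real \<times> real) set)" by (intro countable_SIGMA countable_rat)
    ultimately show "countable (Q n)" by (rule countable_subset)
    show "Q n \<noteq> {}" using Q0 by blast
    show "(\<lambda>p. {\<omega> \<in> space M. \<bar>W (fst p) \<omega> - W (snd p) \<omega>\<bar> \<le> r}) ` Q n \<subseteq> events"
    proof safe
      fix s t assume "(s, t) \<in> Q n"
      then have [measurable]: "W s \<in> borel_measurable M" "W t \<in> borel_measurable M"
        by (auto simp: Q_def intro: meas)
      show "{\<omega> \<in> space M. \<bar>W (fst (s, t)) \<omega> - W (snd (s, t)) \<omega>\<bar> \<le> r} \<in> events" by simp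
    qed
  qed
  have "incseq S"
  proof (rule incseq_SucI)
    fix n
    have "2 / real (Suc (Suc n)) \<le> 2 / real (Suc n)" by (intro divide_left_mono) auto
    then have "Q (Suc n) \<subseteq> Q n" by (auto simp: Q_def simp del: of_nat_Suc)
    then show "S n \<subseteq> S (Suc n)" unfolding S_def by blast
  qed
  then have lim: "(\<lambda>n. prob (S n)) \<longlonglongrightarrow> prob (\<Union>n. S n)"
    using sets by (intro finite_Lim_measure_incseq) auto
  have "AE \<omega> in M. \<omega> \<in> (\<Union>n. S n)"
    using cont AE_space
  proof eventually_elim
    case (elim \<omega>)
    then have "uniformly_continuous_on {0..1} (\<lambda>t. W t \<omega>)" by (intro compact_uniformly_continuous) auto
    then obtain \<delta> where \<delta>: "\<delta> > 0"
      "\<And>s t. s \<in> {0..1} \<Longrightarrow> t \<in> {0..1} \<Longrightarrow> dist t s < \<delta> \<Longrightarrow> dist (W t \<omega>) (W s \<omega>) < r"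
      using r unfolding uniformly_continuous_on_def by metis
    obtain n where "2 / \<delta> < real n" using reals_Archimedean2 by blast
    then have n: "2 / \<delta> < real (Suc n)" by simp
    then have "2 / real (Suc n) < \<delta>" using \<delta>(1) by (simp add: field_simps)
    then have "\<bar>W s \<omega> - W t \<omega>\<bar> \<le> r" if "(s, t) \<in> Q n" for s t
      using that \<delta>(2)[of t s] by (auto simp: Q_def dist_real_def simp del: of_nat_Suc)
    then have "\<omega> \<in> S n" using elim by (auto simp: S_def)
    then show ?case by blast
  qed
  then have "prob (\<Union>n. S n) = 1" using sets by (subst prob_eq_1) auto
  moreover have "AE \<omega> in M. \<forall>n. \<omega> \<in> S n \<longrightarrow>
       (\<forall>s\<in>{0..1}. \<forall>t\<in>{0..1}. \<bar>s - t\<bar> \<le> 1 / real (Suc n) \<longrightarrow> \<bar>W s \<omega> - W t \<omega>\<bar> \<le> r)"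
    using cont
  proof eventually_elim
    case (elim \<omega>)
    show ?case
    proof (intro allI impI ballI)
      fix n s t assume S: "\<omega> \<in> S n" and st: "s \<in> {0..1}" "t \<in> {0..1}" "\<bar>s - t\<bar> \<le> 1 / real (Suc n)"
      have "\<bar>W s \<omega> - W t \<omega>\<bar> \<le> r" if "s \<in> \<rat> \<inter> {0..1}" "t \<in> \<rat> \<inter> {0..1}" "\<bar>s - t\<bar> < 2 / real (Suc n)" for s t
        using S that unfolding S_def Q_def by auto
      moreover have "1 / real (Suc n) < 2 / real (Suc n)" by (intro divide_strict_right_mono) auto
      then have "\<bar>s - t\<bar> < 2 / real (Suc n)" using st by linarith
      ultimately show "\<bar>W s \<omega> - W t \<omega>\<bar> \<le> r"
        using st by (intro oscillation_extends_from_rationals[OF elim, of "2 / real (Suc n)" r s t]) auto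
    qed
  qed
  ultimately show thesis using that[OF sets] lim by simp
qed

section \<open>The pursuit strategy for the Wiener process\<close>

lemma wiener_increments_PiM:
  assumes W: "wiener_process M W" and m: "m > 0"
  shows "distr M (PiM {..<m} (\<lambda>_. borel))
      (\<lambda>\<omega>. \<lambda>i\<in>{..<m}. W (real (Suc i) * (1 / real m)) \<omega> - W (real i * (1 / real m)) \<omega>)
    = PiM {..<m} (\<lambda>_. gaussian (sqrt (1 / real m)))"
proof -
  interpret prob_space M using W by (simp add: wiener_process_def)
  let ?t = "\<lambda>i. real i * (1 / real m)"
  let ?\<xi> = "\<lambda>i \<omega>. W (?t (Suc i)) \<omega> - W (?t i) \<omega>"
  have t: "0 \<le> ?t i" "?t i < ?t (Suc i)" for i using m by (auto simp: field_simps)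
  have t1: "?t (Suc i) \<le> 1" if "i < m" for i using that m by (simp add: field_simps)
  have increments: "\<forall>(n::nat) t. 0 \<le> t 0 \<and> (\<forall>i<n. t i < t (Suc i)) \<and> t n \<le> 1 \<longrightarrow>
      indep_vars (\<lambda>_. borel) (\<lambda>i \<omega>. W (t (Suc i)) \<omega> - W (t i) \<omega>) {..<n}"
    and normal: "\<forall>s t. 0 \<le> s \<and> s < t \<and> t \<le> 1 \<longrightarrow>
      distributed M lborel (\<lambda>\<omega>. W t \<omega> - W s \<omega>) (normal_density 0 (sqrt (t - s)))"
    using W[unfolded wiener_process_def] by - (elim conjE, assumption)+
  have "0 \<le> ?t 0 \<and> (\<forall>i<m. ?t i < ?t (Suc i)) \<and> ?t m \<le> 1" using t m by auto
  then have indep: "indep_vars (\<lambda>_. borel) ?\<xi> {..<m}"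
    by (rule increments[THEN spec, THEN spec, THEN mp])
  have distr: "distr M borel (?\<xi> i) = gaussian (sqrt (1 / real m))" if "i < m" for i
  proof -
    have "distributed M lborel (?\<xi> i) (normal_density 0 (sqrt (?t (Suc i) - ?t i)))"
      by (rule normal[THEN spec, THEN spec, THEN mp]) (intro conjI t t1 that)
    moreover have "?t (Suc i) - ?t i = 1 / real m" by (simp add: add_divide_distrib)
    ultimately have "distr M lborel (?\<xi> i) = gaussian (sqrt (1 / real m))"
      by (simp add: distributed_distr_eq_density)
    moreover have "distr M lborel (?\<xi> i) = distr M borel (?\<xi> i)" by (rule distr_cong) auto
    ultimately show ?thesis by simp
  qed
  have rv: "random_variable borel (?\<xi> i)" if "i \<in> {..<m}" for i
    using indep that unfolding indep_vars_def by blast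
  have "distr M (PiM {..<m} (\<lambda>_. borel)) (\<lambda>\<omega>. \<lambda>i\<in>{..<m}. ?\<xi> i \<omega>) = PiM {..<m} (\<lambda>i. distr M borel (?\<xi> i))"
    using indep_vars_iff_distr_eq_PiM'[of "{..<m}" ?\<xi> "\<lambda>_. borel"] indep rv m by auto
  also have "\<dots> = PiM {..<m} (\<lambda>_. gaussian (sqrt (1 / real m)))"
    by (intro PiM_cong refl distr) simp
  finally show ?thesis .
qed

text \<open>The lower bound for the probability depends on the ratio of \<open>\<alpha>\<^sup>2\<close> and \<open>\<rho>\<close> only. With \<open>\<alpha> = \<theta> / \<epsilon>\<close> and
\<open>\<rho> = (r / \<epsilon>)\<^sup>2\<close> it is therefore the same for all \<open>\<epsilon>\<close>.\<close>

lemma taut_string_energy_small_with_positive_probability: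
  assumes W: "wiener_process M W" and \<epsilon>: "\<epsilon> > 0" and \<alpha>: "pi / 2 < \<alpha> * \<epsilon>" and \<rho>: "\<alpha>\<^sup>2 < \<rho>"
  obtains A where "A \<in> sets M" "measure M A \<ge> (1 - \<alpha>\<^sup>2 / \<rho>) / 2"
    "\<And>\<omega>. \<omega> \<in> A \<Longrightarrow> taut_string_energy (\<lambda>t. W t \<omega>) \<epsilon> \<le> ennreal (sqrt \<rho>)"
proof -
  interpret prob_space M using W by (simp add: wiener_process_def)
  have meas: "\<And>t. t \<in> {0..1} \<Longrightarrow> W t \<in> borel_measurable M"
    and W0: "AE \<omega> in M. W 0 \<omega> = 0"
    and cont: "AE \<omega> in M. continuous_on {0..1} (\<lambda>t. W t \<omega>)"
    using W by (auto simp: wiener_process_def)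
  have "0 < \<alpha> * \<epsilon>" using \<alpha> pi_gt_zero by linarith
  then have \<alpha>0: "\<alpha> > 0" using \<epsilon> by (simp add: zero_less_mult_iff)
  have \<rho>0: "\<rho> > 0" using \<rho> \<alpha>0 by (meson less_trans zero_less_power)
  \<comment> \<open>The potential equals \<open>\<rho>\<close> at \<open>a\<close>, so leaving \<open>[- a, a]\<close> is as bad as spending \<open>\<rho>\<close>.\<close>
  define a where "a = arccos (exp (- \<rho> / 2)) / \<alpha>"
  have e: "0 < exp (- \<rho> / 2)" "exp (- \<rho> / 2) < 1" using \<rho>0 by auto
  have cos_a: "cos (\<alpha> * a) = exp (- \<rho> / 2)" using \<alpha>0 e by (simp add: a_def cos_arccos_abs)
  have "arccos (exp (- \<rho> / 2)) < arccos 0" using e by (intro arccos_less_arccos) auto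
  then have a2: "\<alpha> * a < pi / 2" using \<alpha>0 by (simp add: a_def)
  have "arccos 1 < arccos (exp (- \<rho> / 2))"
    using e by (intro arccos_less_arccos) (auto intro: order_trans[of _ 0])
  then have a0: "a > 0" using \<alpha>0 by (simp add: a_def)
  have "\<alpha> * a < \<alpha> * \<epsilon>" using a2 \<alpha> by linarith
  then have a\<epsilon>: "a < \<epsilon>" using \<alpha>0 by simp
  have outside: "potential \<alpha> a x = \<rho>" if "\<bar>x\<bar> > a" for x
    using potential_outside[OF that] cos_a by simp
  define p where "p = 1 - \<alpha>\<^sup>2 / \<rho>"
  have p: "p > 0" using \<rho> \<rho>0 by (simp add: p_def)
  define r where "r = (\<epsilon> - a) / 2"
  have r: "r > 0" using a\<epsilon> by (simp add: r_def)
  obtain D where D: "D \<ge> 0" and step: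
    "\<And>x \<Delta>. \<bar>x\<bar> \<le> a \<Longrightarrow> 0 < \<Delta> \<Longrightarrow> \<Delta> \<le> 1 \<Longrightarrow>
       (\<integral>\<^sup>+y. ennreal (potential \<alpha> a (x + drift \<alpha> x * \<Delta> - y)) \<partial>gaussian (sqrt \<Delta>))
         + ennreal ((drift \<alpha> x)\<^sup>2 * \<Delta>)
       \<le> ennreal (potential \<alpha> a x + (\<alpha>\<^sup>2 + D * sqrt \<Delta>) * \<Delta>)"
    using potential_step[OF \<alpha>0 a0 a2] by blast
  obtain S where S: "\<And>n::nat. S n \<in> sets M" "(\<lambda>n. prob (S n)) \<longlonglongrightarrow> 1"
    "AE \<omega> in M. \<forall>n. \<omega> \<in> S n \<longrightarrow>
       (\<forall>s\<in>{0..1}. \<forall>t\<in>{0..1}. \<bar>s - t\<bar> \<le> 1 / real (Suc n) \<longrightarrow> \<bar>W s \<omega> - W t \<omega>\<bar> \<le> r)"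
    using small_oscillation_events[OF meas cont r] by blast
  have "\<forall>\<^sub>F n in sequentially. prob (S n) > 1 - p / 4"
    using p by (intro order_tendstoD(1)[OF S(2)]) simp
  moreover have "\<forall>\<^sub>F n in sequentially. D * sqrt (1 / real (Suc n)) < \<rho> * p / 4"
  proof (rule order_tendstoD(2))
    show "(\<lambda>n. D * sqrt (1 / real (Suc n))) \<longlonglongrightarrow> D * sqrt 0"
      by (intro tendsto_mult tendsto_const tendsto_real_sqrt LIMSEQ_Suc[OF lim_1_over_n])
    show "D * sqrt 0 < \<rho> * p / 4" using \<rho>0 p by simp
  qed
  moreover have "\<forall>\<^sub>F n in sequentially. \<alpha> * tan (\<alpha> * a) * (1 / real (Suc n)) < r"
  proof (rule order_tendstoD(2))
    show "(\<lambda>n. \<alpha> * tan (\<alpha> * a) * (1 / real (Suc n))) \<longlonglongrightarrow> \<alpha> * tan (\<alpha> * a) * 0"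
      by (intro tendsto_mult tendsto_const LIMSEQ_Suc[OF lim_1_over_n])
  qed (use r in simp)
  ultimately have "\<forall>\<^sub>F n in sequentially. prob (S n) > 1 - p / 4 \<and> D * sqrt (1 / real (Suc n)) < \<rho> * p / 4
      \<and> \<alpha> * tan (\<alpha> * a) * (1 / real (Suc n)) < r"
    by eventually_elim auto
  then obtain n where n: "prob (S n) > 1 - p / 4" "D * sqrt (1 / real (Suc n)) < \<rho> * p / 4"
      "\<alpha> * tan (\<alpha> * a) * (1 / real (Suc n)) < r"
    using eventually_happens'[OF sequentially_bot] by blast
  define m \<Delta> where "m = Suc n" and "\<Delta> = 1 / real m"
  have m: "m > 0" and \<Delta>: "0 < \<Delta>" "\<Delta> \<le> 1" by (auto simp: m_def \<Delta>_def)
  define \<xi> where "\<xi> \<omega> = (\<lambda>i\<in>{..<m}. W (real (Suc i) * (1 / real m)) \<omega> - W (real i * (1 / real m)) \<omega>)" for \<omega>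
  have \<xi>_meas: "\<xi> \<in> measurable M (PiM {..<m} (\<lambda>_. borel))"
    unfolding \<xi>_def[abs_def]
  proof (rule measurable_restrict)
    fix i assume "i \<in> {..<m}"
    then have "real i * (1 / real m) \<in> {0..1}" "real (Suc i) * (1 / real m) \<in> {0..1}"
      by (auto simp: field_simps)
    then show "(\<lambda>\<omega>. W (real (Suc i) * (1 / real m)) \<omega> - W (real i * (1 / real m)) \<omega>) \<in> borel_measurable M"
      by (intro borel_measurable_diff meas)
  qed
  define F where "F x = ennreal (potential \<alpha> a (walk \<alpha> a \<Delta> x m)) + ennreal (walk_cost \<alpha> a \<Delta> x m)" for x
  have F_meas: "F \<in> borel_measurable (PiM {..<m} (\<lambda>_. borel))"
  proof -
    have [measurable]: "(\<lambda>x. walk \<alpha> a \<Delta> x m) \<in> borel_measurable (PiM {..<m} (\<lambda>_. borel))"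
      "(\<lambda>x. walk_cost \<alpha> a \<Delta> x m) \<in> borel_measurable (PiM {..<m} (\<lambda>_. borel))"
      by (auto intro!: borel_measurable_walk borel_measurable_walk_cost)
    show ?thesis unfolding F_def[abs_def] by measurable
  qed
  have F\<xi> [measurable]: "(\<lambda>\<omega>. F (\<xi> \<omega>)) \<in> borel_measurable M"
    using measurable_compose[OF \<xi>_meas F_meas] .
  define c where "c = (\<alpha>\<^sup>2 + D * sqrt \<Delta>) * \<Delta>"
  have c: "c \<ge> 0" using D \<Delta> by (simp add: c_def)
  have "(\<integral>\<^sup>+\<omega>. F (\<xi> \<omega>) \<partial>M) = (\<integral>\<^sup>+x. F x \<partial>distr M (PiM {..<m} (\<lambda>_. borel)) \<xi>)"
    using nn_integral_distr[OF \<xi>_meas, of F] F_meas by simp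
  also have "distr M (PiM {..<m} (\<lambda>_. borel)) \<xi> = PiM {..<m} (\<lambda>_. gaussian (sqrt \<Delta>))"
    unfolding \<xi>_def[abs_def] \<Delta>_def by (rule wiener_increments_PiM[OF W m])
  also have "(\<integral>\<^sup>+x. F x \<partial>PiM {..<m} (\<lambda>_. gaussian (sqrt \<Delta>))) \<le> ennreal (real m * c)"
    unfolding F_def using \<alpha>0 a0 a2 \<Delta> c
    by (intro walk_expected_cost) (auto simp: c_def intro!: step)
  also have "real m * c = \<alpha>\<^sup>2 + D * sqrt \<Delta>" using m by (simp add: c_def \<Delta>_def)
  also have "ennreal \<dots> \<le> ennreal (\<alpha>\<^sup>2 + \<rho> * p / 4)"
    using n(2) by (intro ennreal_leI) (simp add: \<Delta>_def m_def)
  finally have expect: "(\<integral>\<^sup>+\<omega>. F (\<xi> \<omega>) \<partial>M) \<le> ennreal (\<alpha>\<^sup>2 + \<rho> * p / 4)" .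
  define B where "B = {\<omega> \<in> space M. 1 \<le> ennreal (1 / \<rho>) * F (\<xi> \<omega>)}"
  have B: "B \<in> sets M" unfolding B_def by measurable
  have "prob B \<le> 1 - 3 * p / 4"
  proof -
    have "emeasure M B \<le> ennreal (1 / \<rho>) * (\<integral>\<^sup>+\<omega>. F (\<xi> \<omega>) * indicator (space M) \<omega> \<partial>M)"
      unfolding B_def by (rule nn_integral_Markov_inequality) auto
    also have "(\<integral>\<^sup>+\<omega>. F (\<xi> \<omega>) * indicator (space M) \<omega> \<partial>M) = (\<integral>\<^sup>+\<omega>. F (\<xi> \<omega>) \<partial>M)"
      by (rule nn_integral_cong) auto
    also have "ennreal (1 / \<rho>) * (\<integral>\<^sup>+\<omega>. F (\<xi> \<omega>) \<partial>M) \<le> ennreal (1 / \<rho>) * ennreal (\<alpha>\<^sup>2 + \<rho> * p / 4)"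
      by (intro mult_left_mono expect) auto
    also have "\<dots> = ennreal (1 / \<rho> * (\<alpha>\<^sup>2 + \<rho> * p / 4))"
      using \<rho>0 p by (intro ennreal_mult[symmetric]) auto
    also have "1 / \<rho> * (\<alpha>\<^sup>2 + \<rho> * p / 4) = 1 - 3 * p / 4"
      using \<rho>0 by (simp add: p_def field_simps)
    finally have "ennreal (prob B) \<le> ennreal (1 - 3 * p / 4)" by (simp add: emeasure_eq_measure)
    moreover have "0 \<le> 1 - 3 * p / 4"
    proof -
      have "p \<le> 1" using \<rho>0 by (simp add: p_def)
      then show ?thesis by simp
    qed
    ultimately show ?thesis by simp
  qed
  moreover have "prob (S n) \<le> prob (S n - B) + prob B"
  proof -
    have "prob (S n) \<le> prob ((S n - B) \<union> B)" using S(1) B by (intro finite_measure_mono) auto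
    also have "\<dots> \<le> prob (S n - B) + prob B" using S(1) B by (intro measure_Un_le) auto
    finally show ?thesis .
  qed
  ultimately have pA: "prob (S n - B) \<ge> p / 2" using n(1) by linarith
  have "AE \<omega> in M. \<omega> \<in> S n - B \<longrightarrow> taut_string_energy (\<lambda>t. W t \<omega>) \<epsilon> \<le> ennreal (sqrt \<rho>)"
    using S(3) W0 AE_space
  proof eventually_elim
    case (elim \<omega>)
    show ?case
    proof
      assume \<omega>: "\<omega> \<in> S n - B"
      let ?Z = "walk_cost \<alpha> a \<Delta> (\<xi> \<omega>) m" and ?V = "potential \<alpha> a (walk \<alpha> a \<Delta> (\<xi> \<omega>) m)"
      have Z: "?Z \<ge> 0" using walk_cost_nonneg \<Delta> by simp
      have V: "?V \<ge> 0" using potential_nonneg \<alpha>0 a0 a2 by simp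
      have "\<not> 1 \<le> ennreal (1 / \<rho>) * F (\<xi> \<omega>)" using elim \<omega> by (simp add: B_def)
      moreover have "ennreal (1 / \<rho>) * F (\<xi> \<omega>) = ennreal ((?V + ?Z) / \<rho>)"
        using \<rho>0 V Z by (simp add: F_def ennreal_plus[symmetric] ennreal_mult[symmetric] del: ennreal_plus)
      ultimately have "(?V + ?Z) / \<rho> < 1" by simp
      then have VZ: "?V + ?Z < \<rho>" using \<rho>0 by simp
      then have "\<bar>walk \<alpha> a \<Delta> (\<xi> \<omega>) m\<bar> \<le> a"
        using outside[of "walk \<alpha> a \<Delta> (\<xi> \<omega>) m"] Z
        by (cases "a < \<bar>walk \<alpha> a \<Delta> (\<xi> \<omega>) m\<bar>") auto
      then have "taut_string_energy (\<lambda>t. W t \<omega>) \<epsilon> \<le> ennreal (sqrt ?Z)"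
        unfolding \<Delta>_def
      proof (rule taut_string_energy_le_walk_cost[where w = "\<lambda>t. W t \<omega>" and r = r,
            OF m \<alpha>0 a0 a2 elim(2)])
        show "\<xi> \<omega> k = W (real (Suc k) * (1 / real m)) \<omega> - W (real k * (1 / real m)) \<omega>" if "k < m" for k
          using that by (simp add: \<xi>_def)
        show "\<bar>W s \<omega> - W t \<omega>\<bar> \<le> r"
          if "s \<in> {0..1}" "t \<in> {0..1}" "\<bar>s - t\<bar> \<le> 1 / real m" for s t
          using elim(1) \<omega> that unfolding m_def by blast
        have "\<alpha> * tan (\<alpha> * a) / real m < r" using n(3) by (simp add: m_def)
        then show "a + \<alpha> * tan (\<alpha> * a) / real m + r \<le> \<epsilon>" unfolding r_def by argo
      qed
      also have "\<dots> \<le> ennreal (sqrt \<rho>)" using VZ V by (intro ennreal_leI) simp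
      finally show "taut_string_energy (\<lambda>t. W t \<omega>) \<epsilon> \<le> ennreal (sqrt \<rho>)" .
    qed
  qed
  then obtain N where N: "N \<in> null_sets M"
    "\<And>\<omega>. \<omega> \<in> space M - N \<Longrightarrow> \<omega> \<in> S n - B \<longrightarrow> taut_string_energy (\<lambda>t. W t \<omega>) \<epsilon> \<le> ennreal (sqrt \<rho>)"
    by (auto elim!: AE_E3)
  show thesis
  proof (rule that[of "S n - B - N"])
    show "S n - B - N \<in> sets M" using S(1) B N by auto
    show "(1 - \<alpha>\<^sup>2 / \<rho>) / 2 \<le> prob (S n - B - N)"
      using pA N S(1) B by (simp add: p_def measure_Diff_null_set)
    show "taut_string_energy (\<lambda>t. W t \<omega>) \<epsilon> \<le> ennreal (sqrt \<rho>)" if "\<omega> \<in> S n - B - N" for \<omega>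
      using N(2)[of \<omega>] that sets.sets_into_space[OF S(1)[of n]] by auto
  qed
qed

section \<open>The bound for the constant\<close>

theorem mainTheorem3:
  fixes M :: "'a measure" and W :: "real \<Rightarrow> 'a \<Rightarrow> real" and C :: real
  assumes "wiener_process M W"
    and "is_taut_string_constant M W C"
  shows "C \<le> pi / 2"
proof (rule ccontr)
  assume "\<not> C \<le> pi / 2"
  then obtain r where r: "pi / 2 < r" "r < C" using dense by (meson not_le)
  obtain \<theta> where \<theta>: "pi / 2 < \<theta>" "\<theta> < r" using dense r by blast
  have pos: "0 < \<theta>" "0 < r" using \<theta> r pi_gt_zero by linarith+
  define p where "p = (1 - \<theta>\<^sup>2 / r\<^sup>2) / 2"
  have p: "p > 0" using \<theta> pos by (simp add: p_def power_strict_mono)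
  have lower: "ennreal ((C - r) * p) \<le> (\<integral>\<^sup>+\<omega>. scaled_deviation C 1 \<epsilon> (taut_string_energy (\<lambda>t. W t \<omega>) \<epsilon>) \<partial>M)"
    if \<epsilon>: "\<epsilon> > 0" for \<epsilon>
  proof -
    interpret prob_space M using assms by (simp add: wiener_process_def)
    have "(\<theta> / \<epsilon>)\<^sup>2 < (r / \<epsilon>)\<^sup>2" using \<theta> pos \<epsilon> by (intro power_strict_mono divide_strict_right_mono) auto
    then obtain A where A: "A \<in> sets M" "measure M A \<ge> (1 - (\<theta> / \<epsilon>)\<^sup>2 / (r / \<epsilon>)\<^sup>2) / 2"
      "\<And>\<omega>. \<omega> \<in> A \<Longrightarrow> taut_string_energy (\<lambda>t. W t \<omega>) \<epsilon> \<le> ennreal (sqrt ((r / \<epsilon>)\<^sup>2))"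
      using taut_string_energy_small_with_positive_probability[OF assms(1) \<epsilon>, of "\<theta> / \<epsilon>" "(r / \<epsilon>)\<^sup>2"] \<theta> \<epsilon>
      by auto
    have "(\<theta> / \<epsilon>)\<^sup>2 / (r / \<epsilon>)\<^sup>2 = \<theta>\<^sup>2 / r\<^sup>2" using \<epsilon> by (simp add: power_divide)
    then have pA: "prob A \<ge> p" using A(2) by (simp add: p_def)
    have dev: "ennreal (C - r) \<le> scaled_deviation C 1 \<epsilon> (taut_string_energy (\<lambda>t. W t \<omega>) \<epsilon>)" if "\<omega> \<in> A" for \<omega>
    proof -
      let ?I = "taut_string_energy (\<lambda>t. W t \<omega>) \<epsilon>"
      have I: "?I \<le> ennreal (r / \<epsilon>)" using A(3)[OF that] pos \<epsilon> by simp
      then have fin: "?I \<noteq> \<infinity>" by (auto simp: top_unique)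
      have "enn2real ?I \<le> r / \<epsilon>" using I pos \<epsilon> by (intro enn2real_leI) auto
      then have "\<epsilon> * enn2real ?I \<le> r" using \<epsilon> by (simp add: field_simps)
      then show ?thesis using fin r by (auto simp: scaled_deviation_def intro!: ennreal_leI)
    qed
    have "ennreal ((C - r) * p) \<le> ennreal (C - r) * emeasure M A"
      using r p pA by (simp add: emeasure_eq_measure ennreal_mult[symmetric] mult_left_mono)
    also have "\<dots> = (\<integral>\<^sup>+\<omega>. ennreal (C - r) * indicator A \<omega> \<partial>M)"
      using A(1) by (simp add: nn_integral_cmult_indicator)
    also have "\<dots> \<le> (\<integral>\<^sup>+\<omega>. scaled_deviation C 1 \<epsilon> (taut_string_energy (\<lambda>t. W t \<omega>) \<epsilon>) \<partial>M)"
      using dev by (intro nn_integral_mono) (auto split: split_indicator)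
    finally show ?thesis .
  qed
  have "((\<lambda>\<epsilon>. \<integral>\<^sup>+\<omega>. scaled_deviation C 1 \<epsilon> (taut_string_energy (\<lambda>t. W t \<omega>) \<epsilon>) \<partial>M) \<longlongrightarrow> 0) (at_right 0)"
    using assms(2) by (simp add: is_taut_string_constant_def)
  then have "ennreal ((C - r) * p) \<le> 0"
    by (rule tendsto_lowerbound) (auto simp: eventually_at_right_less lower intro: eventually_mono[OF eventually_at_right_less])
  then show False using r p by (simp add: ennreal_eq_0_iff mult_le_0_iff)
qed
end
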